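(* Let $k\ge2$ and suppose that a nonnegative $k$-regular sequence $f$ has a reduced representation $(\mathbf w,\mathcal B,\mathbf x)$ such that the spectral radius $\rho$ is the unique eigenvalue of maximal modulus of $\widehat{\mathbf B}$ and is a simple eigenvalue of $\widehat{\mathbf B}$. Then the unique ghost measure $\mu_f$ of $f$ is spectrally pure, that is, $\mu_f=(\mu_f)_{\bullet}$ for some $\bullet\in\{\mathrm{pp},\mathrm{sc},\mathrm{ac}\}$, where $(\cdot)_{\mathrm{pp}},(\cdot)_{\mathrm{sc}},(\cdot)_{\mathrm{ac}}$ denote the pure point, singular continuous and absolutely continuous parts in the Lebesgue decomposition (with respect to Lebesgue measure on $\mathbb T$).
   Context: Fix an integer $k\ge2$. For $n\ge1$ let $(n)_k=i_s\cdots i_0$ be the base-$k$ expansion ($i_s\ne0$), and for matrices $\mathbf B_0,\dots,\mathbf B_{k-1}$ put $\mathbf B_{(n)_k}=\mathbf B_{i_s}\cdots\mathbf B_{i_0}$, $\mathbf B_{(0)_k}=$ identity. A linear representation of degree $d$ of a real sequence $f$ is a tuple $(\mathbf w,\mathcal B,\mathbf x)$ with $\mathbf w,\mathbf x\in\mathbb R^d$, $\mathcal B=\{\mathbf B_0,\dots,\mathbf B_{k-1}\}\subset\mathbb R^{d\times d}$, and $f(n)=\mathbf w^T\mathbf B_{(n)_k}\mathbf x$ for all $n\ge0$; sequences with such a representation are $k$-regular. Put $\mathbf B=\sum_i\mathbf B_i$. For nonnegative $f$ put $\Sigma_f(N)=\sum_{m=k^N}^{k^{N+1}-1}f(m)$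 and, when $\Sigma_f(N)\ne0$, $\mu_N=\frac1{\Sigma_f(N)}\sum_{m=0}^{k^{N+1}-k^N-1}f(k^N+m)\,\delta_{m/(k^N(k-1))}$, a probability measure on $\mathbb T=[0,1)$ with addition mod 1. Ghost measures of $f$ are the weak accumulation points of $(\mu_N)_N$. Let $V\subset\mathbb R^d$ be the subspace with $V^T=\mathrm{span}\{\mathbf w^T\mathbf B_{(n)_k}:n\ge1\}$, $\mathbf P_V$ the orthogonal projection onto $V$, $\widetilde{\mathbf B}_i=\mathbf P_V\mathbf B_i\mathbf P_V$, $\widetilde{\mathbf B}=\mathbf P_V\mathbf B\mathbf P_V$. The tuple $(\mathbf w,\mathcal B,\mathbf x)$ is a reduced representation of the nonnegative sequence $f$ if: (i) the spectral radius $\rho=\rho(\widetilde{\mathbf B})$ (with $\rho>0$) is an eigenvalue of $\widetilde{\mathbf B}$ and the only one of modulus $\rho$; (ii) $\mathbf x$ is a $\rho$-eigenvector of $\widetilde{\mathbf B}$; (iii) $\Sigma_f(n)=\rho^n$ for all $n\in\mathbb N$; (iv) $f$ has a unique ghost measure $\mu_f$. Let $\widehat V=\mathrm{span}\{\widetilde{\mathbf B}_0^n\widetilde{\mathbf B}_{(m)_k}\mathbf x:m,n\ge0\}$ (with $\widetilde{\mathbf B}_{(0)_k}$ the identity), $\mathbf P_{\widehat V}$ the orthogonal projection onto $\widehat V$, $\widehat{\mathbf B}_i=\mathbf P_{\widehat V}\widetilde{\mathbf B}_i\mathbf P_{\widehat V}$, $\widehat{\mathbf B}=\sum_i\widehat{\mathbf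 B}_i$; one has $\rho(\widehat{\mathbf B})=\rho$. *)

theory Defs
  imports "HOL-Probability.Probability" "HOL-Computational_Algebra.Polynomial"
begin

definition complexify :: "real^'n^'n \<Rightarrow> complex^'n^'n" where
  "complexify A = map_matrix complex_of_real A"

definition eigenvalue :: "complex^'n^'n \<Rightarrow> complex \<Rightarrow> bool" where
  "eigenvalue A c \<longleftrightarrow> (\<exists>v. v \<noteq> 0 \<and> A *v v = c *s v)"

definition spectral_radius :: "complex^'n^'n \<Rightarrow> real" where
  "spectral_radius A = Max (cmod ` {c. eigenvalue A c})"

definition char_poly :: "complex^'n^'n \<Rightarrow> complex poly" where
  "char_poly A = det (\<chi> i j. (if i = j then [:0, 1:] else 0) - [:A $ i $ j:])"

text \<open>Simplicity refers to the algebraic multiplicity.\<close>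

definition simple_eigenvalue :: "complex^'n^'n \<Rightarrow> complex \<Rightarrow> bool" where
  "simple_eigenvalue A c \<longleftrightarrow> eigenvalue A c \<and> order c (char_poly A) = 1"

definition unique_maximal_eigenvalue :: "complex^'n^'n \<Rightarrow> complex \<Rightarrow> bool" where
  "unique_maximal_eigenvalue A c \<longleftrightarrow>
     eigenvalue A c \<and> (\<forall>c'. eigenvalue A c' \<and> c' \<noteq> c \<longrightarrow> cmod c' < cmod c)"

definition orth_proj :: "(real^'n) set \<Rightarrow> real^'n^'n" where
  "orth_proj V = matrix (\<lambda>v. THE u. u \<in> V \<and> (\<forall>y\<in>V. orthogonal (v - u) y))"

text \<open>
  A family of \<open>k\<close> matrices is a function on \<^typ>\<open>nat\<close> of which only the values at
  \<open>0, \<dots>, k - 1\<close> are ever used. The product runs over the base-\<open>k\<close> digits of \<open>n\<close>, with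
  the factor of the most significant digit on the left; it is the identity for \<open>n = 0\<close>.
  The guard \<open>k < 2\<close> only serves termination.
\<close>

function digit_prod :: "nat \<Rightarrow> (nat \<Rightarrow> real^'d^'d) \<Rightarrow> nat \<Rightarrow> real^'d^'d" where
  "digit_prod k B n =
     (if n = 0 \<or> k < 2 then mat 1 else digit_prod k B (n div k) ** B (n mod k))"
  by pat_completeness auto
termination
  by (relation "Wellfounded.measure (\<lambda>(k, B, n). n)") auto

declare digit_prod.simps [simp del]

definition linear_representation ::
  "nat \<Rightarrow> (nat \<Rightarrow> real) \<Rightarrow> real^'d \<Rightarrow> (nat \<Rightarrow> real^'d^'d) \<Rightarrow> real^'d \<Rightarrow> bool" where
  "linear_representation k f w B x \<longleftrightarrow> (\<forall>n. f n = w \<bullet> (digit_prod k B n *v x))"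

definition V_space :: "nat \<Rightarrow> real^'d \<Rightarrow> (nat \<Rightarrow> real^'d^'d) \<Rightarrow> (real^'d) set" where
  "V_space k w B = span {w v* digit_prod k B n | n. n \<ge> 1}"

definition B_tilde :: "nat \<Rightarrow> real^'d \<Rightarrow> (nat \<Rightarrow> real^'d^'d) \<Rightarrow> nat \<Rightarrow> real^'d^'d" where
  "B_tilde k w B i = orth_proj (V_space k w B) ** B i ** orth_proj (V_space k w B)"

definition B_tilde_sum :: "nat \<Rightarrow> real^'d \<Rightarrow> (nat \<Rightarrow> real^'d^'d) \<Rightarrow> real^'d^'d" where
  "B_tilde_sum k w B = orth_proj (V_space k w B) ** (\<Sum>i<k. B i) ** orth_proj (V_space k w B)"

text \<open>
  The power of a matrix is written as an iterate of its action on vectors, because \<open>^\<close> on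
  \<^typ>\<open>real^'d^'d\<close> is the componentwise power.
\<close>

definition V_hat ::
  "nat \<Rightarrow> real^'d \<Rightarrow> (nat \<Rightarrow> real^'d^'d) \<Rightarrow> real^'d \<Rightarrow> (real^'d) set" where
  "V_hat k w B x =
     span {((\<lambda>v. B_tilde k w B 0 *v v) ^^ n) (digit_prod k (B_tilde k w B) m *v x) | m n. True}"

definition B_hat ::
  "nat \<Rightarrow> real^'d \<Rightarrow> (nat \<Rightarrow> real^'d^'d) \<Rightarrow> real^'d \<Rightarrow> nat \<Rightarrow> real^'d^'d" where
  "B_hat k w B x i = orth_proj (V_hat k w B x) ** B_tilde k w B i ** orth_proj (V_hat k w B x)"

definition B_hat_sum ::
  "nat \<Rightarrow> real^'d \<Rightarrow> (nat \<Rightarrow> real^'d^'d) \<Rightarrow> real^'d \<Rightarrow> real^'d^'d" where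
  "B_hat_sum k w B x = (\<Sum>i<k. B_hat k w B x i)"

text \<open>
  The torus is the interval \<open>[0, 1)\<close> with its endpoints identified. The identification does
  not affect the Borel sets, but it does affect the weak topology: the test functions are the
  continuous functions on the torus, that is, the continuous 1-periodic functions on the line.
\<close>

definition torus_borel :: "real measure" where
  "torus_borel = restrict_space borel {0..<1}"

definition torus_lebesgue :: "real measure" where
  "torus_lebesgue = restrict_space lborel {0..<1}"

definition torus_continuous :: "(real \<Rightarrow> real) set" where
  "torus_continuous = {g. continuous_on UNIV g \<and> (\<forall>t. g (t + 1) = g t)}"

definition block_sum :: "nat \<Rightarrow> (nat \<Rightarrow> real) \<Rightarrow> nat \<Rightarrow> real" where
  "block_sum k f N = (\<Sum>m = k ^ N ..< k ^ (N + 1). f m)"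

text \<open>
  The weighted sum of Dirac measures is the image of a measure on the finite index set; it is
  meaningful only if the block sum does not vanish.
\<close>

definition block_measure :: "nat \<Rightarrow> (nat \<Rightarrow> real) \<Rightarrow> nat \<Rightarrow> real measure" where
  "block_measure k f N =
     distr (point_measure {0 ..< k ^ (N + 1) - k ^ N}
              (\<lambda>m. ennreal (f (k ^ N + m) / block_sum k f N)))
       torus_borel (\<lambda>m. real m / (real k ^ N * (real k - 1)))"

text \<open>
  Weak accumulation points: every basic weak neighbourhood of \<open>\<nu>\<close>, given by finitely many test
  functions and a tolerance, contains infinitely many members of the sequence.
\<close>

definition ghost_measure :: "nat \<Rightarrow> (nat \<Rightarrow> real) \<Rightarrow> real measure \<Rightarrow> bool" where
  "ghost_measure k f \<nu> \<longleftrightarrow>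
     prob_space \<nu> \<and> sets \<nu> = sets torus_borel \<and>
     (\<forall>G \<epsilon>. finite G \<and> G \<subseteq> torus_continuous \<and> \<epsilon> > 0 \<longrightarrow>
        (\<exists>\<^sub>F N in sequentially. block_sum k f N \<noteq> 0 \<and>
           (\<forall>g\<in>G. \<bar>(\<integral>t. g t \<partial>block_measure k f N) - (\<integral>t. g t \<partial>\<nu>)\<bar> < \<epsilon>)))"

definition the_ghost_measure :: "nat \<Rightarrow> (nat \<Rightarrow> real) \<Rightarrow> real measure" where
  "the_ghost_measure k f = (THE \<nu>. ghost_measure k f \<nu>)"

definition rep_radius :: "nat \<Rightarrow> real^'d \<Rightarrow> (nat \<Rightarrow> real^'d^'d) \<Rightarrow> real" where
  "rep_radius k w B = spectral_radius (complexify (B_tilde_sum k w B))"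

definition reduced_representation ::
  "nat \<Rightarrow> (nat \<Rightarrow> real) \<Rightarrow> real^'d \<Rightarrow> (nat \<Rightarrow> real^'d^'d) \<Rightarrow> real^'d \<Rightarrow> bool" where
  "reduced_representation k f w B x \<longleftrightarrow>
     linear_representation k f w B x \<and>
     rep_radius k w B > 0 \<and>
     eigenvalue (complexify (B_tilde_sum k w B)) (complex_of_real (rep_radius k w B)) \<and>
     (\<forall>c. eigenvalue (complexify (B_tilde_sum k w B)) c \<and> cmod c = rep_radius k w B \<longrightarrow>
          c = complex_of_real (rep_radius k w B)) \<and>
     x \<noteq> 0 \<and> B_tilde_sum k w B *v x = rep_radius k w B *\<^sub>R x \<and>
     (\<forall>n. block_sum k f n = rep_radius k w B ^ n) \<and>
     (\<exists>!\<nu>. ghost_measure k f \<nu>)"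

definition pure_point :: "real measure \<Rightarrow> bool" where
  "pure_point M \<longleftrightarrow> (\<exists>C. countable C \<and> C \<subseteq> space M \<and> emeasure M (space M - C) = 0)"

definition singular_continuous :: "real measure \<Rightarrow> bool" where
  "singular_continuous M \<longleftrightarrow>
     (\<forall>t\<in>space M. emeasure M {t} = 0) \<and>
     (\<exists>Z\<in>null_sets torus_lebesgue. emeasure M (space M - Z) = 0)"

text \<open>
  The decomposition of a finite Borel measure on the torus exists and is unique, which makes
  the descriptions below well defined.
\<close>

definition lebesgue_decomposition ::
  "real measure \<Rightarrow> real measure \<Rightarrow> real measure \<Rightarrow> real measure \<Rightarrow> bool" where
  "lebesgue_decomposition M P S A \<longleftrightarrow>
     sets P = sets M \<and> sets S = sets M \<and> sets A = sets M \<and>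
     (\<forall>E\<in>sets M. emeasure M E = emeasure P E + emeasure S E + emeasure A E) \<and>
     pure_point P \<and> singular_continuous S \<and> absolutely_continuous torus_lebesgue A"

definition pp_part :: "real measure \<Rightarrow> real measure" where
  "pp_part M = (THE P. \<exists>S A. lebesgue_decomposition M P S A)"

definition sc_part :: "real measure \<Rightarrow> real measure" where
  "sc_part M = (THE S. \<exists>P A. lebesgue_decomposition M P S A)"

definition ac_part :: "real measure \<Rightarrow> real measure" where
  "ac_part M = (THE A. \<exists>P S. lebesgue_decomposition M P S A)"

definition spectrally_pure :: "real measure \<Rightarrow> bool" where
  "spectrally_pure M \<longleftrightarrow> M = pp_part M \<or> M = sc_part M \<or> M = ac_part M"

end

theory Submission
  imports Defs
begin

text \<open>
  Prepending a word \<open>n \<ge> 1\<close> to all integers turns \<open>f\<close> into a positive measure \<open>\<nu>\<^sub>n\<close> on the line, the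
  limit of the masses \<open>f (n k\<^sup>s + r) / \<rho>\<^sup>s\<close> at \<open>r / k\<^sup>s\<close>. These measures are self-similar, and the
  ghost measure is a sum of affine images of \<open>\<nu>\<^sub>1, \<dots>, \<nu>\<^sub>k\<^sub>-\<^sub>1\<close>. If a Borel set \<open>E\<close> is invariant under
  rational affine maps, the sequence \<open>n \<mapsto> \<nu>\<^sub>n E\<close> satisfies the same recursion and the same linear
  relations as \<open>f\<close>, so it is given by a \<open>\<rho>\<close>-eigenvector of \<open>B_hat_sum\<close>; as \<open>\<rho>\<close> is simple,
  \<open>\<nu>\<^sub>n E = c f n\<close>. By self-similarity \<open>E\<close> then splits every Borel set in the proportion \<open>c\<close>, and
  splitting \<open>E\<close> itself gives \<open>c \<in> {0, 1}\<close>. This zero-one law, applied to the orbits of an atom and of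
  a Lebesgue null set, forces the ghost measure to be pure.
\<close>

section \<open>Simple eigenvalues and orthogonal projections\<close>

text \<open>Row linearity \<open>det_row_mul\<close> carried over by transposition. It pulls the
  factor \<open>z - c\<close> out of a column replaced by Cramer's rule.\<close>

lemma det_mult_column:
  fixes M :: "'a::comm_ring_1^'n^'n"
  shows "det (\<chi> r s. if s = i then c * a r else M $ r $ s) =
         c * det (\<chi> r s. if s = i then a r else M $ r $ s)"
proof -
  have *: "transpose (\<chi> r s. if s = i then b r else M $ r $ s) =
        (\<chi> s. if s = i then (\<chi> r. b r) else (\<chi> r. M $ r $ s))" for b :: "'n \<Rightarrow> 'a"
    by (simp add: transpose_def vec_eq_iff)
  have "(\<chi> r. c * a r) = c *s (\<chi> r. a r)"
    by (simp add: vec_eq_iff)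
  moreover have "det (\<chi> r s. if s = i then b r else M $ r $ s) =
      det (\<chi> s. if s = i then (\<chi> r. b r) else (\<chi> r. M $ r $ s))" for b :: "'n \<Rightarrow> 'a"
    by (subst det_transpose[symmetric]) (simp only: *)
  ultimately show ?thesis
    using det_row_mul[of i c "\<lambda>_. \<chi> r. a r" "\<lambda>s. \<chi> r. M $ r $ s"]
    by (simp only:)
qed

lemma poly_det: "poly (det M) z = det (\<chi> i j. poly (M $ i $ j) z)"
  for M :: "'a::comm_ring_1 poly^'n^'n"
  by (simp add: det_def poly_sum poly_prod)

text \<open>The reversed polynomial \<open>q\<close> has value 1 at 0. If \<open>char_poly A\<close>
  were zero, \<open>q\<close> would vanish at every \<open>t \<noteq> 0\<close> and so be zero as
  well. Nonvanishing is what lets \<open>order\<close> bound the powers of a linear factor that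
  divide \<open>char_poly A\<close>.\<close>

lemma char_poly_nonzero: "char_poly A \<noteq> 0"
proof
  assume "char_poly A = 0"
  define q where "q = det (\<chi> i j. (if i = j then 1 else 0) - [:0, A $ i $ j:])"
  have q: "poly q t = det (\<chi> i j. (if i = j then 1 else 0) - t * A $ i $ j)" for t
    by (auto simp: q_def poly_det vec_eq_iff intro!: arg_cong[where f = det])
  have "poly q t = 0" if "t \<noteq> 0" for t
  proof -
    have "0 = poly (char_poly A) (1 / t)"
      using \<open>char_poly A = 0\<close> by simp
    also have "\<dots> = det (\<chi> i j. (if i = j then 1 / t else 0) - A $ i $ j)"
      by (auto simp: char_poly_def poly_det vec_eq_iff intro!: arg_cong[where f = det])
    finally have "det (\<chi> i. t *s (\<chi> j. (if i = j then 1 / t else 0) - A $ i $ j)) = 0"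
      by (subst det_rows_mul) simp
    moreover have "(\<chi> i. t *s (\<chi> j. (if i = j then 1 / t else 0) - A $ i $ j)) =
        (\<chi> i j. (if i = j then 1 else 0) - t * A $ i $ j)"
      using that by (auto simp: vec_eq_iff algebra_simps)
    ultimately show ?thesis
      by (simp add: q)
  qed
  then have "- {0} \<subseteq> {t. poly q t = 0}"
    by auto
  then have "infinite {t. poly q t = 0}"
    using infinite_UNIV_char_0 finite_subset by (metis finite_compl finite.emptyI finite.insertI)
  then have "q = 0"
    using poly_roots_finite by blast
  moreover have "poly q 0 = 1"
    using det_I[where 'a = complex and 'n = 'a] by (simp add: q mat_def)
  ultimately show False by simp
qed

text \<open>
  Two independent eigenvectors, the second normalised to vanish at a coordinate \<open>i\<close> of the first,
  replace two columns of \<open>z I - A\<close> by multiples of \<open>z - c\<close> (Cramer's rule).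
\<close>

lemma square_dvd_char_poly:
  assumes u: "A *v u = c *s u" and v: "A *v v = c *s v"
    and i: "u $ i \<noteq> 0" "v $ i = 0" and j: "v $ j \<noteq> 0"
  shows "[:- c, 1:] ^ 2 dvd char_poly A"
proof -
  define X :: "complex poly^'a^'a" where
    "X = (\<chi> r s. if s = j then [:v $ r:] else if s = i then [:u $ r:]
            else (if r = s then [:0, 1:] else 0) - [:A $ r $ s:])"
  have "i \<noteq> j" using i j by auto
  have "poly (smult (u $ i * v $ j) (char_poly A)) z = poly ([:- c, 1:] ^ 2 * det X) z" for z
  proof -
    define M :: "complex^'a^'a" where "M = mat z - A"
    define N where "N = (\<chi> r s. if s = i then u $ r else M $ r $ s)"
    have Mv: "(M *v y) $ r = (z - c) * y $ r" if "A *v y = c *s y" for y r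
    proof -
      have "mat z *v y = z *s y"
        by (simp add: matrix_vector_mult_def mat_def vec_eq_iff if_distrib if_distribR cong: if_cong)
      then show ?thesis
        using that by (simp add: M_def matrix_vector_mult_diff_rdistrib left_diff_distrib)
    qed
    \<comment> \<open>The matrices differ only in column \<open>i\<close>, where \<open>v\<close>
      vanishes, so \<open>N\<close> still maps \<open>v\<close> to \<open>(z - c) v\<close>.\<close>
    have "N *v v = M *v v"
      using i(2) by (auto simp: N_def vec_eq_iff matrix_vector_mult_def intro!: sum.cong)
    then have Nv: "(N *v v) $ r = (z - c) * v $ r" for r
      using Mv[OF v] by simp
    have "poly (char_poly A) z = det M"
      by (auto simp: char_poly_def poly_det M_def mat_def intro!: arg_cong[where f = det] simp: vec_eq_iff)
    moreover have "u $ i * det M = (z - c) * det N"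
      using cramer_lemma[of i M u] Mv[OF u] det_mult_column[of i "z - c" "\<lambda>r. u $ r" M]
      by (simp add: N_def cong: if_cong)
    moreover have "v $ j * det N = (z - c) * det (\<chi> r s. if s = j then v $ r else N $ r $ s)"
      using cramer_lemma[of j N v] Nv det_mult_column[of j "z - c" "\<lambda>r. v $ r" N]
      by (simp cong: if_cong)
    moreover have "(\<chi> r s. if s = j then v $ r else N $ r $ s) = (\<chi> r s. poly (X $ r $ s) z)"
      by (auto simp: vec_eq_iff N_def X_def M_def mat_def)
    ultimately have "u $ i * poly (char_poly A) z = (z - c) * det N"
      "v $ j * det N = (z - c) * poly (det X) z"
      by (simp_all add: poly_det)
    then have "u $ i * v $ j * poly (char_poly A) z = (z - c) * ((z - c) * poly (det X) z)"
      by (metis mult.assoc mult.left_commute)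
    then show ?thesis
      by (simp add: power2_eq_square left_diff_distrib right_diff_distrib)
  qed
  then have "smult (u $ i * v $ j) (char_poly A) = [:- c, 1:] ^ 2 * det X"
    by (simp add: poly_eq_poly_eq_iff[symmetric] fun_eq_iff)
  then have "[:- c, 1:] ^ 2 dvd smult (u $ i * v $ j) (char_poly A)"
    by simp
  then show ?thesis
    using i j by (simp add: dvd_smult_iff)
qed

text \<open>Subtracting the multiple of \<open>u\<close> that cancels a coordinate \<open>i\<close>
  with \<open>u $ i \<noteq> 0\<close> prepares \<open>v\<close> for
  \<open>square_dvd_char_poly\<close>; a nonzero remainder would make \<open>c\<close> a double
  root.\<close>

lemma simple_eigenvalue_collinear:
  assumes "simple_eigenvalue A c" and u: "A *v u = c *s u" "u \<noteq> 0" and v: "A *v v = c *s v"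
  obtains b where "v = b *s u"
proof -
  obtain i where i: "u $ i \<noteq> 0"
    using u(2) by (auto simp: vec_eq_iff)
  define b where "b = v $ i / u $ i"
  have "v - b *s u = 0"
  proof (rule ccontr)
    assume "v - b *s u \<noteq> 0"
    then obtain j where j: "(v - b *s u) $ j \<noteq> 0"
      by (auto simp: vec_eq_iff)
    have "A *v (v - b *s u) = c *s (v - b *s u)"
      using u v by (simp add: matrix_vector_mult_diff_distrib vec.scale vec_eq_iff algebra_simps)
    moreover have "(v - b *s u) $ i = 0"
      using i by (simp add: b_def)
    ultimately have "[:- c, 1:] ^ 2 dvd char_poly A"
      using square_dvd_char_poly[OF u(1) _ i _ j] by blast
    moreover have "order c (char_poly A) = 1"
      using assms(1) by (simp add: simple_eigenvalue_def)
    moreover have "char_poly A \<noteq> 0"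
      by (simp add: char_poly_nonzero)
    ultimately show False
      using order_divides[of c 2 "char_poly A"] by simp
  qed
  then show thesis
    using that by (metis eq_iff_diff_eq_0)
qed

text \<open>The scalar found over the complex numbers can be replaced by its real part, as both
  vectors are real.\<close>

lemma real_simple_eigenvalue_collinear:
  fixes A :: "real^'n^'n"
  assumes "simple_eigenvalue (complexify A) (complex_of_real c)"
    and u: "A *v u = c *\<^sub>R u" "u \<noteq> 0" and v: "A *v v = c *\<^sub>R v"
  obtains b where "v = b *\<^sub>R u"
proof -
  define C :: "real^'n \<Rightarrow> complex^'n" where "C y = (\<chi> i. complex_of_real (y $ i))" for y
  have C: "complexify A *v C y = complex_of_real c *s C y" if "A *v y = c *\<^sub>R y" for y
  proof -
    have "complexify A *v C y = C (A *v y)"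
      by (simp add: complexify_def map_matrix_def C_def matrix_vector_mult_def vec_eq_iff)
    then show ?thesis
      using that by (simp add: C_def vec_eq_iff)
  qed
  obtain i where i: "u $ i \<noteq> 0"
    using u(2) by (auto simp: vec_eq_iff)
  then have "C u \<noteq> 0"
    by (auto simp: C_def vec_eq_iff)
  then obtain b where b: "C v = b *s C u"
    using simple_eigenvalue_collinear[OF assms(1) C[OF u(1)] _ C[OF v]] by blast
  have "complex_of_real (v $ l) = b * complex_of_real (u $ l)" for l
    using b by (simp add: C_def vec_eq_iff)
  then have "v $ l = Re b * u $ l" for l
    using arg_cong[where f = Re] by fastforce
  then have "v = Re b *\<^sub>R u"
    by (simp add: vec_eq_iff)
  then show thesis ..
qed

section \<open>Orthogonal projections as matrices\<close>

lemma orth_proj: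
  fixes V :: "(real^'n) set"
  assumes "subspace V"
  shows orth_proj_mem: "orth_proj V *v v \<in> V"
    and orth_proj_orthogonal: "y \<in> V \<Longrightarrow> orthogonal (v - orth_proj V *v v) y"
proof -
  \<comment> \<open>Uniqueness makes the \<open>THE\<close> in \<open>orth_proj\<close> meaningful.
    It also yields linearity below, without which \<open>matrix\<close> would not represent the
    map.\<close>
  have uniq: "u = u'" if "u \<in> V" "\<forall>y\<in>V. orthogonal (v - u) y" "u' \<in> V" "\<forall>y\<in>V. orthogonal (v - u') y"
    for u u' v :: "real^'n"
  proof -
    have m: "u - u' \<in> V" using assms that by (simp add: subspace_diff)
    have "(v - u) \<bullet> (u - u') = 0" "(v - u') \<bullet> (u - u') = 0"
      using that m by (auto simp: orthogonal_def)
    then have "(u - u') \<bullet> (u - u') = 0"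
      by (simp add: inner_diff_left)
    then show ?thesis by simp
  qed
  define p :: "real^'n \<Rightarrow> real^'n" where "p v = (THE u. u \<in> V \<and> (\<forall>y\<in>V. orthogonal (v - u) y))" for v
  have ex: "\<exists>u. u \<in> V \<and> (\<forall>y\<in>V. orthogonal (v - u) y)" for v
    using orthogonal_subspace_decomp_exists[of V v] span_eq_iff[of V] assms
    by (metis add_diff_cancel_left')
  have p: "p v \<in> V \<and> (\<forall>y\<in>V. orthogonal (v - p v) y)" for v
    unfolding p_def using ex[of v] by (rule exE) (rule theI, auto intro: uniq)
  have "linear p"
  proof (rule linearI)
    fix a b :: "real^'n" and r :: real
    have "orthogonal (a + b - (p a + p b)) y" if "y \<in> V" for y
      using p[of a] p[of b] that by (simp add: orthogonal_def inner_diff_left inner_add_left)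
    then show "p (a + b) = p a + p b"
      using p assms by (intro uniq[of _ "a + b"]) (auto simp: subspace_add)
    have "orthogonal (r *\<^sub>R a - r *\<^sub>R p a) y" if "y \<in> V" for y
      using p[of a] that by (simp add: orthogonal_def inner_diff_left)
    then show "p (r *\<^sub>R a) = r *\<^sub>R p a"
      using p assms by (intro uniq[of _ "r *\<^sub>R a"]) (auto simp: subspace_scale)
  qed
  then have "orth_proj V *v v = p v" for v
    using matrix_works[of p v] by (simp add: orth_proj_def p_def[abs_def] linear_matrix_vector_mul_eq)
  then show "orth_proj V *v v \<in> V" "y \<in> V \<Longrightarrow> orthogonal (v - orth_proj V *v v) y"
    using p by auto
qed

lemma orth_proj_inner:
  assumes "subspace V" "y \<in> V"
  shows "y \<bullet> (orth_proj V *v v) = y \<bullet> v"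
  using orth_proj_orthogonal[OF assms, of v]
  by (simp add: orthogonal_def inner_diff_left inner_commute[of y])

lemma orth_proj_id:
  assumes "subspace V" "v \<in> V"
  shows "orth_proj V *v v = v"
proof -
  have "orthogonal (v - orth_proj V *v v) (v - orth_proj V *v v)"
    using assms by (intro orth_proj_orthogonal subspace_diff orth_proj_mem)
  then show ?thesis by (simp add: orthogonal_def)
qed

lemma vector_matrix_orth_proj:
  assumes "subspace V" "v \<in> V"
  shows "v v* orth_proj V = v"
proof (rule vector_eq_rdot[THEN iffD1], rule allI)
  fix z
  show "(v v* orth_proj V) \<bullet> z = v \<bullet> z"
    using orth_proj_inner[OF assms] by (simp add: dot_lmul_matrix)
qed

section \<open>Sequences with the linear relations of a reduced representation\<close>

lemma sum_matrix_vector_mult: "(\<Sum>a\<in>A. M a) *v y = (\<Sum>a\<in>A. M a *v y)"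
  for M :: "'b \<Rightarrow> real^'n^'m"
  by (induction A rule: infinite_finite_induct) (simp_all add: matrix_vector_mult_add_rdistrib)

lemma digit_prod_append_digit:
  assumes "k \<ge> 2" "a < k" "n \<ge> 1"
  shows "digit_prod k B (n * k + a) = digit_prod k B n ** B a"
  using assms by (subst digit_prod.simps) auto

text \<open>As a word of length \<open>s\<close>, \<open>r\<close> may begin with zeros, which
  \<open>digit_prod k B r\<close> drops; the \<open>p\<close> factors \<open>B 0\<close> restore
  them. The same \<open>p\<close> serves all prefixes \<open>n\<close>.\<close>

lemma digit_prod_append_word:
  assumes "k \<ge> 2" "r < k ^ s"
  shows "\<exists>p. \<forall>n\<ge>1. \<forall>z. digit_prod k B (n * k ^ s + r) *v z =
    digit_prod k B n *v (((*v) (B 0) ^^ p) (digit_prod k B r *v z))"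
  using assms(2)
proof (induction s arbitrary: r)
  case 0
  then have "r = 0" by simp
  then show ?case
    by (intro exI[of _ 0]) (simp add: digit_prod.simps[of k B 0])
next
  case (Suc s)
  define b where "b = r mod k"
  have r: "r = r div k * k + b" and b: "b < k"
    using assms(1) by (simp_all add: b_def)
  have "r div k < k ^ s"
    using Suc.prems assms(1) by (simp add: less_mult_imp_div_less mult.commute)
  from Suc.IH[OF this] obtain p where p: "\<And>n z. n \<ge> 1 \<Longrightarrow> digit_prod k B (n * k ^ s + r div k) *v z =
    digit_prod k B n *v (((*v) (B 0) ^^ p) (digit_prod k B (r div k) *v z))"
    by blast
  have *: "digit_prod k B (n * k ^ Suc s + r) = digit_prod k B (n * k ^ s + r div k) ** B b" if "n \<ge> 1" for n
  proof -
    have "n * k ^ Suc s + r = (n * k ^ s + r div k) * k + b"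
      using r by (simp add: algebra_simps)
    moreover have "n * k ^ s + r div k \<ge> 1"
      using that assms(1) by (simp add: Suc_le_eq)
    ultimately show ?thesis
      using digit_prod_append_digit[OF assms(1) b] by simp
  qed
  \<comment> \<open>For \<open>r = 0\<close> the appended digit is one more leading zero; otherwise
    it belongs to the expansion of \<open>r\<close> and \<open>p\<close> is kept.\<close>
  show ?case
  proof (cases "r = 0")
    case True
    then have "b = 0" by (simp add: b_def)
    then have "\<forall>n\<ge>1. \<forall>z. digit_prod k B (n * k ^ Suc s + r) *v z =
      digit_prod k B n *v (((*v) (B 0) ^^ Suc p) (digit_prod k B r *v z))"
      using True p *
      by (simp add: digit_prod.simps[of k B 0] matrix_vector_mul_assoc[symmetric] funpow_swap1
          del: power_Suc)
    then show ?thesis ..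
  next
    case False
    then have "digit_prod k B r = digit_prod k B (r div k) ** B b"
      using assms(1) by (subst digit_prod.simps) (simp add: b_def)
    then have "\<forall>n\<ge>1. \<forall>z. digit_prod k B (n * k ^ Suc s + r) *v z =
      digit_prod k B n *v (((*v) (B 0) ^^ p) (digit_prod k B r *v z))"
      using p * by (simp add: matrix_vector_mul_assoc[symmetric] del: power_Suc)
    then show ?thesis ..
  qed
qed

section \<open>Compression to the spaces \<open>V_space\<close> and \<open>V_hat\<close>\<close>

context
  fixes k :: nat and w :: "real^'d" and B :: "nat \<Rightarrow> real^'d^'d"
  assumes k: "k \<ge> 2"
begin

lemma V_space_generator: "n \<ge> 1 \<Longrightarrow> w v* digit_prod k B n \<in> V_space k w B"
  by (auto simp: V_space_def intro!: span_base)

lemma subspace_V_space: "subspace (V_space k w B)"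
  by (simp add: V_space_def)

text \<open>Multiplying a generator by \<open>B a\<close> from the right appends the digit
  \<open>a\<close> to its index.\<close>

lemma V_space_invariant:
  assumes "v \<in> V_space k w B" "a < k"
  shows "v v* B a \<in> V_space k w B"
  using assms(1) unfolding V_space_def
proof (induction rule: span_induct)
  case base
  have "(c *\<^sub>R v) v* B a = c *\<^sub>R (v v* B a)" for c v
    by (simp add: vector_matrix_mult_def vec_eq_iff sum_distrib_left mult.assoc)
  then show ?case
    by (auto simp: subspace_def vector_matrix_left_distrib
        intro: span_add span_scale span_zero)
next
  case (step v)
  then obtain n where "n \<ge> 1" "v = w v* digit_prod k B n" by auto
  then have "v v* B a = w v* digit_prod k B (n * k + a)"
    using digit_prod_append_digit[OF k assms(2) \<open>n \<ge> 1\<close>, of B] by (simp add: vector_matrix_mul_assoc)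
  then show ?case
    using V_space_generator[of "n * k + a"] \<open>n \<ge> 1\<close> k by (simp add: V_space_def Suc_le_eq)
qed

text \<open>By invariance both projections in \<open>B_tilde\<close> fix the row vectors that they
  meet.\<close>

lemma B_tilde_left:
  assumes "v \<in> V_space k w B" "a < k"
  shows "v v* B_tilde k w B a = v v* B a"
  using assms vector_matrix_orth_proj[OF subspace_V_space] V_space_invariant
  by (simp add: B_tilde_def vector_matrix_mul_assoc[symmetric])

lemma digit_prod_tilde_left:
  assumes "v \<in> V_space k w B"
  shows "v v* digit_prod k (B_tilde k w B) n = v v* digit_prod k B n \<and>
    v v* digit_prod k B n \<in> V_space k w B"
proof (induction n rule: less_induct)
  case (less n)
  show ?case
  proof (cases "n = 0")
    case True
    then show ?thesis
      using assms by (simp add: digit_prod.simps[of k _ 0])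
  next
    case False
    then have *: "digit_prod k C n = digit_prod k C (n div k) ** C (n mod k)" for C :: "nat \<Rightarrow> real^'d^'d"
      using k by (subst digit_prod.simps) simp
    show ?thesis
      using less[of "n div k"] False k
      by (simp add: * vector_matrix_mul_assoc[symmetric] B_tilde_left V_space_invariant)
  qed
qed

lemma word_tilde_left:
  assumes "v \<in> V_space k w B"
  shows "v \<bullet> ((*v) (B 0) ^^ p) (digit_prod k B r *v z) =
    v \<bullet> ((*v) (B_tilde k w B 0) ^^ p) (digit_prod k (B_tilde k w B) r *v z)"
  using assms
proof (induction p arbitrary: v)
  case 0
  then show ?case
    using digit_prod_tilde_left by (simp add: dot_lmul_matrix[symmetric])
next
  case (Suc p)
  then show ?case
    using V_space_invariant[of v 0] B_tilde_left[of v 0] k by (simp add: dot_lmul_matrix[symmetric])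
qed

text \<open>The vector \<open>y\<close> is a generator of \<open>V_hat\<close> determined by the
  suffix alone; the leading zeros of the suffix account for the powers of
  \<open>B_tilde k w B 0\<close> in the definition of \<open>V_hat\<close>.\<close>

lemma V_hat_values:
  assumes "linear_representation k f w B x" "r < k ^ s"
  shows "\<exists>y\<in>V_hat k w B x. \<forall>n\<ge>1. f (n * k ^ s + r) = (w v* digit_prod k B n) \<bullet> y"
proof -
  obtain p where p: "\<And>n. n \<ge> 1 \<Longrightarrow> digit_prod k B (n * k ^ s + r) *v x =
    digit_prod k B n *v (((*v) (B 0) ^^ p) (digit_prod k B r *v x))"
    using digit_prod_append_word[OF k assms(2)] by blast
  let ?y = "((*v) (B_tilde k w B 0) ^^ p) (digit_prod k (B_tilde k w B) r *v x)"
  have "?y \<in> V_hat k w B x"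
    unfolding V_hat_def by (intro span_base) auto
  moreover have "f (n * k ^ s + r) = (w v* digit_prod k B n) \<bullet> ?y" if "n \<ge> 1" for n
    using assms(1) p[OF that] word_tilde_left[OF V_space_generator[OF that], of p r x]
    by (simp add: linear_representation_def dot_lmul_matrix)
  ultimately show ?thesis by blast
qed

lemma B_tilde_mem: "B_tilde k w B a *v y \<in> V_space k w B"
  by (simp add: B_tilde_def matrix_vector_mul_assoc[symmetric] orth_proj_mem[OF subspace_V_space])

lemma B_tilde_sum_mem: "B_tilde_sum k w B *v y \<in> V_space k w B"
  by (simp add: B_tilde_sum_def matrix_vector_mul_assoc[symmetric] orth_proj_mem[OF subspace_V_space])

lemma B_tilde_sum_apply: "B_tilde_sum k w B *v y = (\<Sum>a<k. B_tilde k w B a *v y)"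
  by (simp add: B_tilde_sum_def B_tilde_def matrix_vector_mul_assoc[symmetric]
      sum_matrix_vector_mult linear_sum[OF matrix_vector_mul_linear])

lemma V_hat_subset:
  assumes "x \<in> V_space k w B"
  shows "V_hat k w B x \<subseteq> V_space k w B"
proof -
  have 1: "digit_prod k (B_tilde k w B) m *v y \<in> V_space k w B" if "y \<in> V_space k w B" for m y
    using that
  proof (induction m arbitrary: y rule: less_induct)
    case (less m)
    then show ?case
      using k B_tilde_mem
      by (cases "m = 0") (subst digit_prod.simps, simp add: matrix_vector_mul_assoc[symmetric])+
  qed
  have 2: "((\<lambda>v. B_tilde k w B 0 *v v) ^^ n) y \<in> V_space k w B" if "y \<in> V_space k w B" for n y
    using that B_tilde_mem by (cases n) auto
  show ?thesis
    unfolding V_hat_def using 1 2 assms by (intro span_minimal subspace_V_space) auto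
qed

lemma B_hat_sum_apply:
  assumes "y \<in> V_hat k w B x"
  shows "B_hat_sum k w B x *v y = orth_proj (V_hat k w B x) *v (B_tilde_sum k w B *v y)"
proof -
  have "subspace (V_hat k w B x)" by (simp add: V_hat_def)
  then show ?thesis
    using assms
    by (simp add: B_hat_sum_def B_hat_def B_tilde_sum_apply matrix_vector_mul_assoc[symmetric]
        sum_matrix_vector_mult linear_sum[OF matrix_vector_mul_linear] orth_proj_id)
qed

text \<open>Translates between the eigenvalue equation of \<open>B_tilde_sum\<close> and the
  recursion over an appended digit.\<close>

lemma generator_inner_B_tilde_sum:
  assumes "n \<ge> 1"
  shows "(w v* digit_prod k B n) \<bullet> (B_tilde_sum k w B *v y) =
    (\<Sum>a<k. (w v* digit_prod k B (n * k + a)) \<bullet> y)"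
  using assms k
  by (auto simp: B_tilde_sum_apply inner_sum_right dot_lmul_matrix[symmetric] B_tilde_left
      V_space_generator digit_prod_append_digit vector_matrix_mul_assoc[symmetric] intro!: sum.cong)

end

text \<open>
  The functional that sends the projection of \<open>w v* digit_prod k B n\<close> to \<open>m n\<close> is represented by a
  vector of \<open>V_hat\<close>, read off from the orthogonal complement of its graph. The recursion makes this
  vector an eigenvector.
\<close>

lemma proportional_to_sequence:
  fixes w x :: "real^'d"
  assumes k: "k \<ge> 2" and red: "reduced_representation k f w B x"
    and simple: "simple_eigenvalue (complexify (B_hat_sum k w B x)) (complex_of_real (rep_radius k w B))"
    and rec: "\<And>n. n \<ge> 1 \<Longrightarrow> (\<Sum>a<k. m (n * k + a)) = rep_radius k w B * m n"
    and rel: "\<And>(I :: ((real^'d) \<times> real) set) g c. finite I \<Longrightarrow> (\<And>i. i \<in> I \<Longrightarrow> g i \<ge> 1) \<Longrightarrow>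
      (\<And>s r. r < k ^ s \<Longrightarrow> (\<Sum>i\<in>I. c i * f (g i * k ^ s + r)) = 0) \<Longrightarrow>
      (\<Sum>i\<in>I. c i * m (g i)) = 0"
  shows "\<exists>c. \<forall>n\<ge>1. m n = c * f n"
proof -
  define \<rho> where "\<rho> = rep_radius k w B"
  define W where "W n = w v* digit_prod k B n" for n
  define V where "V = V_hat k w B x"
  define u where "u n = orth_proj V *v W n" for n
  have lin: "linear_representation k f w B x" and "\<rho> > 0" and "x \<noteq> 0"
    and eig: "B_tilde_sum k w B *v x = \<rho> *\<^sub>R x"
    using red by (auto simp: reduced_representation_def \<rho>_def)
  have sub: "subspace V" by (simp add: V_def V_hat_def)
  have uV: "u n \<in> V" for n
    using orth_proj_mem[OF sub] by (simp add: u_def)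
  have u_inner: "u n \<bullet> y = W n \<bullet> y" if "y \<in> V" for n y
    using orth_proj_inner[OF sub that, of "W n"] by (simp add: u_def inner_commute)
  define T where "T = {(u n, m n) | n. n \<ge> 1}"
  \<comment> \<open>Otherwise some linear relation among the vectors \<open>u n\<close> would fail
    for \<open>m\<close>. But such a relation holds for \<open>f\<close> on all suffixes, by
    \<open>V_hat_values\<close>, so \<open>rel\<close> transfers it to \<open>m\<close>.\<close>
  have "(0, 1) \<notin> span T"
  proof
    assume "(0, 1) \<in> span T"
    then obtain I c where I: "finite I" "I \<subseteq> T" and s: "(0, 1) = (\<Sum>i\<in>I. c i *\<^sub>R i)"
      unfolding span_explicit by blast
    \<comment> \<open>The index set of \<open>rel\<close> consists of points of the graph;
      \<open>g\<close> picks an \<open>n\<close> for each of them.\<close>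
    have "\<forall>i\<in>I. \<exists>n\<ge>1. i = (u n, m n)"
      using I(2) by (auto simp: T_def)
    then obtain g where g: "\<And>i. i \<in> I \<Longrightarrow> g i \<ge> 1 \<and> i = (u (g i), m (g i))"
      by metis
    have "(\<Sum>i\<in>I. c i *\<^sub>R u (g i)) = fst (\<Sum>i\<in>I. c i *\<^sub>R i)"
      by (simp add: fst_sum) (use g in \<open>auto intro!: sum.cong dest: arg_cong[where f = fst]\<close>)
    then have u0: "(\<Sum>i\<in>I. c i *\<^sub>R u (g i)) = 0"
      by (simp add: s[symmetric])
    have "(\<Sum>i\<in>I. c i * m (g i)) = snd (\<Sum>i\<in>I. c i *\<^sub>R i)"
      by (simp add: snd_sum) (use g in \<open>auto intro!: sum.cong dest: arg_cong[where f = snd]\<close>)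
    then have m1: "(\<Sum>i\<in>I. c i * m (g i)) = 1"
      by (simp add: s[symmetric])
    have "(\<Sum>i\<in>I. c i * f (g i * k ^ s + r)) = 0" if r: "r < k ^ s" for s r
    proof -
      obtain y where y: "y \<in> V" "\<And>n. n \<ge> 1 \<Longrightarrow> f (n * k ^ s + r) = W n \<bullet> y"
        using V_hat_values[OF k lin r] unfolding V_def W_def by blast
      have "(\<Sum>i\<in>I. c i * f (g i * k ^ s + r)) = (\<Sum>i\<in>I. c i *\<^sub>R u (g i)) \<bullet> y"
        using g y by (auto simp: inner_sum_left u_inner intro!: sum.cong)
      then show ?thesis by (simp add: u0)
    qed
    then have "(\<Sum>i\<in>I. c i * m (g i)) = 0"
      using rel[of I g c] I(1) g by blast
    then show False using m1 by simp
  qed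
  \<comment> \<open>\<open>z\<close> is the component of \<open>(0, 1)\<close> orthogonal to the
    graph. Its second coordinate equals \<open>z \<bullet> z\<close>, so it is nonzero, and the
    orthogonality relation can be solved for \<open>m n\<close>.\<close>
  obtain t z where t: "t \<in> span T" and z: "\<And>v. v \<in> span T \<Longrightarrow> orthogonal z v" and tz: "(0, 1) = t + z"
    using orthogonal_subspace_decomp_exists[of T "(0, 1) :: (real^'d) \<times> real"] by blast
  have "z \<noteq> 0"
    using tz t \<open>(0, 1) \<notin> span T\<close> by auto
  have "z \<bullet> (0, 1) = z \<bullet> z"
    unfolding tz using z[OF t] by (simp add: inner_add_right orthogonal_def)
  then have nz: "snd z \<noteq> 0"
    using \<open>z \<noteq> 0\<close> by (auto simp: inner_prod_def[of z "(0, 1)"])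
  define x' where "x' = orth_proj V *v ((- 1 / snd z) *\<^sub>R fst z)"
  have x'V: "x' \<in> V"
    using orth_proj_mem[OF sub] by (simp add: x'_def)
  have mW: "m n = W n \<bullet> x'" if "n \<ge> 1" for n
  proof -
    have "(u n, m n) \<in> span T"
      using that by (auto simp: T_def intro!: span_base)
    then have "fst z \<bullet> u n + snd z * m n = 0"
      using z by (auto simp: orthogonal_def inner_prod_def)
    then have "m n = u n \<bullet> ((- 1 / snd z) *\<^sub>R fst z)"
      using nz by (simp add: inner_commute field_simps)
    also have "\<dots> = u n \<bullet> x'"
      unfolding x'_def using orth_proj_inner[OF sub uV] by simp
    also have "\<dots> = W n \<bullet> x'"
      by (rule u_inner[OF x'V])
    finally show ?thesis .
  qed
  have "x = (1 / \<rho>) *\<^sub>R (B_tilde_sum k w B *v x)"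
    using eig \<open>\<rho> > 0\<close> by simp
  then have "x \<in> V_space k w B"
    using B_tilde_sum_mem[OF k, of w B x] subspace_V_space[OF k] by (metis subspace_scale)
  then have VV: "V \<subseteq> V_space k w B"
    unfolding V_def by (rule V_hat_subset[OF k])
  \<comment> \<open>\<open>q\<close> lies in \<open>V_space\<close> and is orthogonal to all of its
    generators, hence it is zero.\<close>
  define q where "q = B_tilde_sum k w B *v x' - \<rho> *\<^sub>R x'"
  have q: "q \<in> V_space k w B"
    unfolding q_def using x'V VV subspace_V_space[OF k] B_tilde_sum_mem[OF k]
    by (intro subspace_diff subspace_scale) auto
  have "W n \<bullet> q = 0" if "n \<ge> 1" for n
  proof -
    have "W n \<bullet> (B_tilde_sum k w B *v x') = (\<Sum>a<k. m (n * k + a))"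
      unfolding W_def generator_inner_B_tilde_sum[OF k that]
      using mW[of "n * k + _"] that k by (auto simp: W_def Suc_le_eq intro!: sum.cong)
    then show ?thesis
      using rec[OF that] mW[OF that] by (simp add: q_def inner_diff_right \<rho>_def)
  qed
  then have "V_space k w B \<subseteq> {v. v \<bullet> q = 0}"
    unfolding V_space_def
    by (intro span_minimal) (auto simp: W_def subspace_def inner_add_left)
  then have "B_tilde_sum k w B *v x' = \<rho> *\<^sub>R x'"
    using q by (auto simp: q_def)
  moreover have xV: "x \<in> V"
    unfolding V_def V_hat_def
    by (rule span_base) (auto intro!: exI[of _ 0] simp: digit_prod.simps[of k _ 0])
  ultimately have "B_hat_sum k w B x *v x' = \<rho> *\<^sub>R x'" "B_hat_sum k w B x *v x = \<rho> *\<^sub>R x"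
    using B_hat_sum_apply[OF k] x'V eig orth_proj_id[OF sub] subspace_scale[OF sub]
    unfolding V_def by metis+
  then obtain b where "x' = b *\<^sub>R x"
    using real_simple_eigenvalue_collinear[OF simple] \<open>x \<noteq> 0\<close> unfolding \<rho>_def by metis
  then have "m n = b * f n" if "n \<ge> 1" for n
    using mW[OF that] lin by (simp add: W_def linear_representation_def dot_lmul_matrix)
  then show ?thesis by blast
qed

lemma reduced_representation_recursion:
  assumes k: "k \<ge> 2" and red: "reduced_representation k f w B x" and n: "n \<ge> 1"
  shows "(\<Sum>a<k. f (n * k + a)) = rep_radius k w B * f n"
proof -
  have f: "f n = (w v* digit_prod k B n) \<bullet> x" for n
    using red by (simp add: reduced_representation_def linear_representation_def dot_lmul_matrix)
  then show ?thesis
    using generator_inner_B_tilde_sum[OF k n, of w B x] red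
    by (simp add: reduced_representation_def)
qed

section \<open>Self-similar measures on the line\<close>

text \<open>The relation is linear in the measures, so the sets satisfying it form a Dynkin system,
  and half-lines are an intersection-stable generator. Coefficients of both signs are
  allowed.\<close>

lemma linear_relation_borel:
  assumes I: "finite I" and M: "\<And>i. i \<in> I \<Longrightarrow> finite_borel_measure (M i)"
    and atMost: "\<And>b. (\<Sum>i\<in>I. c i * measure (M i) {..b}) = 0"
    and E: "E \<in> sets borel"
  shows "(\<Sum>i\<in>I. c i * measure (M i) E) = 0"
proof -
  have sets: "sets (M i) = sets borel" and space: "space (M i) = UNIV" and fin: "finite_measure (M i)"
    if "i \<in> I" for i
    using M[OF that] finite_borel_measure.M_is_borel sets_eq_imp_space_eq[of "M i" borel]
    by (auto simp: finite_borel_measure_def)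
  \<comment> \<open>Closure under complements needs the relation for the whole line, which is a
    limit of half-lines.\<close>
  have "(\<lambda>n. \<Sum>i\<in>I. c i * measure (M i) {..real n}) \<longlonglongrightarrow> (\<Sum>i\<in>I. c i * measure (M i) UNIV)"
    using finite_borel_measure.cdf_lim_infty[OF M] space
    by (intro tendsto_sum tendsto_mult_left) (simp add: cdf_def)
  then have UNIV: "(\<Sum>i\<in>I. c i * measure (M i) UNIV) = 0"
    by (simp add: atMost LIMSEQ_const_iff)
  have borel: "sets borel = sigma_sets UNIV (range (\<lambda>a::real. {..a}))"
    by (subst borel_eq_atMost) simp
  have "Int_stable (range (\<lambda>a::real. {..a}))"
    by (auto simp: Int_stable_def)
  moreover have "range (\<lambda>a::real. {..a}) \<subseteq> Pow UNIV"
    by simp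
  moreover have "E \<in> sigma_sets UNIV (range (\<lambda>a::real. {..a}))"
    using E borel by simp
  ultimately show ?thesis
  proof (induction rule: sigma_sets_induct_disjoint)
    case (basic A)
    then show ?case using atMost by auto
  next
    case empty
    then show ?case by simp
  next
    case (compl A)
    have "measure (M i) (UNIV - A) = measure (M i) UNIV - measure (M i) A" if "i \<in> I" for i
      using finite_measure.finite_measure_compl[OF fin[OF that], of A] compl(1) borel
      by (simp add: sets that space)
    then have "(\<Sum>i\<in>I. c i * measure (M i) (UNIV - A)) =
        (\<Sum>i\<in>I. c i * measure (M i) UNIV) - (\<Sum>i\<in>I. c i * measure (M i) A)"
      by (simp add: sum_subtractf[symmetric] right_diff_distrib)
    then show ?case
      using compl UNIV by simp
  next
    case (union A)
    have "(\<lambda>n. measure (M i) (A n)) sums measure (M i) (\<Union>n. A n)" if "i \<in> I" for i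
      using union(1,2) borel
      by (intro finite_measure.finite_measure_UNION fin that) (auto simp: sets that)
    then have "(\<lambda>n. \<Sum>i\<in>I. c i * measure (M i) (A n)) sums (\<Sum>i\<in>I. c i * measure (M i) (\<Union>n. A n))"
      by (intro sums_sum sums_mult)
    then have "(\<lambda>n. 0) sums (\<Sum>i\<in>I. c i * measure (M i) (\<Union>n. A n))"
      using union(3) by simp
    then show ?case
      by (rule sums_unique2[OF _ sums_zero])
  qed
qed

text \<open>Instance of \<open>linear_relation_borel\<close>: the index \<open>None\<close> stands
  for \<open>M\<close> with coefficient \<open>- \<rho>\<close>, and \<open>Some j\<close> for the
  affine image of \<open>N j\<close> with coefficient 1.\<close>

lemma affine_combination_borel:
  fixes p \<rho> :: real
  assumes J: "finite J" and p: "p > 0" and \<rho>: "\<rho> > 0"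
    and M: "finite_borel_measure M" and N: "\<And>j. j \<in> J \<Longrightarrow> finite_borel_measure (N j)"
    and atMost: "\<And>b. measure M {..b} = (\<Sum>j\<in>J. measure (N j) {..p * b - q j}) / \<rho>"
    and E: "E \<in> sets borel"
  shows "measure M E = (\<Sum>j\<in>J. measure (N j) {t. (q j + t) / p \<in> E}) / \<rho>"
proof -
  define L where
    "L i = (case i of None \<Rightarrow> M | Some j \<Rightarrow> distr (N j) borel (\<lambda>t. (q j + t) / p))" for i
  define c where "c i = (case i of None \<Rightarrow> - \<rho> | Some j \<Rightarrow> 1)" for i :: "'a option"
  have meas: "(\<lambda>t. (q j + t) / p) \<in> measurable (N j) borel" if "j \<in> J" for j
    using finite_borel_measure.M_is_borel[OF N[OF that]] by (simp cong: measurable_cong_sets)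
  have L: "measure (L (Some j)) A = measure (N j) {t. (q j + t) / p \<in> A}"
    if "j \<in> J" "A \<in> sets borel" for j A
  proof -
    have "space (N j) = UNIV"
      using sets_eq_imp_space_eq[OF finite_borel_measure.M_is_borel[OF N[OF that(1)]]] by simp
    then show ?thesis
      using that by (simp add: L_def measure_distr[OF meas] vimage_def)
  qed
  have "(\<Sum>i\<in>insert None (Some ` J). c i * measure (L i) E) = 0"
  proof (rule linear_relation_borel)
    fix i assume "i \<in> insert None (Some ` J)"
    then show "finite_borel_measure (L i)"
      using M N meas
      by (auto simp: L_def finite_borel_measure_def finite_borel_measure_axioms_def
          intro!: finite_measure.finite_measure_distr)
  next
    fix b :: real
    have "measure (L (Some j)) {..b} = measure (N j) {..p * b - q j}" if "j \<in> J" for j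
    proof -
      have "{t. (q j + t) / p \<in> {..b}} = {..p * b - q j}"
        using p by (auto simp: field_simps)
      then show ?thesis
        using L[OF that, of "{..b}"] by simp
    qed
    then show "(\<Sum>i\<in>insert None (Some ` J). c i * measure (L i) {..b}) = 0"
      using J atMost[of b] \<rho>
      by (simp add: sum.reindex c_def) (simp add: L_def)
  qed (use J E in auto)
  then have "(\<Sum>j\<in>J. measure (L (Some j)) E) = \<rho> * measure M E"
    using J by (simp add: sum.reindex c_def) (simp add: L_def)
  then show ?thesis
    using L E \<rho> by simp
qed

section \<open>Distribution functions of the cylinder measures\<close>

locale digit_weights =
  fixes k :: nat and f :: "nat \<Rightarrow> real" and \<rho> :: real
  assumes k: "k \<ge> 2"
    and f_nonneg: "\<And>n. f n \<ge> 0"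
    and rho_pos: "\<rho> > 0"
    and recursion: "\<And>n. n \<ge> 1 \<Longrightarrow> (\<Sum>a<k. f (n * k + a)) = \<rho> * f n"
begin

lemma append_digit_ge: "n \<ge> 1 \<Longrightarrow> n * k + a \<ge> 1"
  using k by (simp add: Suc_le_eq)

text \<open>
  \<open>step_cdf s n\<close> is the distribution function of \<open>\<rho>\<^sup>-\<^sup>s \<Sum>\<^sub>r f (n k\<^sup>s + r) \<delta>\<close>, with
  the unit masses \<open>\<delta>\<close> at \<open>r / k\<^sup>s\<close> for \<open>r < k\<^sup>s\<close>. Point masses at left endpoints make it
  decrease in \<open>s\<close>, so that the limit is right continuous.
\<close>

primrec step_cdf :: "nat \<Rightarrow> nat \<Rightarrow> real \<Rightarrow> real" where
  "step_cdf 0 = (\<lambda>n b. if 0 \<le> b then f n else 0)"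
| "step_cdf (Suc s) = (\<lambda>n b. (\<Sum>a<k. step_cdf s (n * k + a) (real k * b - real a)) / \<rho>)"

lemma step_cdf_nonneg: "step_cdf s n b \<ge> 0"
  using f_nonneg rho_pos by (induction s arbitrary: n b) (auto intro!: sum_nonneg divide_nonneg_pos)

lemma step_cdf_mono: "b \<le> c \<Longrightarrow> step_cdf s n b \<le> step_cdf s n c"
proof (induction s arbitrary: n b c)
  case 0
  then show ?case using f_nonneg by auto
next
  case (Suc s)
  then show ?case
    using rho_pos by (auto intro!: sum_mono divide_right_mono mult_left_mono)
qed

lemma step_cdf_right_cont: "continuous (at_right b) (step_cdf s n)"
proof (induction s arbitrary: n b)
  case 0
  have "\<forall>\<^sub>F c in at_right b. step_cdf 0 n b = step_cdf 0 n c"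
  proof (cases "b \<ge> 0")
    case True
    then show ?thesis
      by (auto simp: eventually_at_right_field intro!: exI[of _ "b + 1"])
  next
    case False
    then show ?thesis
      by (auto simp: eventually_at_right_field intro!: exI[of _ 0])
  qed
  then show ?case
    unfolding continuous_within by (rule Lim_transform_eventually[OF tendsto_const])
next
  case (Suc s)
  have "((\<lambda>c. step_cdf s m (real k * c - real a)) \<longlongrightarrow> step_cdf s m (real k * b - real a)) (at_right b)" for m a
  proof -
    \<comment> \<open>The dilation is increasing, so right neighbourhoods go to right
      neighbourhoods.\<close>
    have "filterlim (\<lambda>c. real k * c - real a) (at_right (real k * b - real a)) (at_right b)"
      using k by (auto simp: filterlim_at intro!: tendsto_intros eventually_at_rightI[of b "b + 1"])
    then show ?thesis
      using Suc[of "real k * b - real a" m] unfolding continuous_within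
      by (rule filterlim_compose[rotated])
  qed
  then show ?case
    using rho_pos unfolding continuous_within by (auto intro!: tendsto_intros)
qed

lemma step_cdf_neg: "b < 0 \<Longrightarrow> step_cdf s n b = 0"
proof (induction s arbitrary: n b)
  case (Suc s)
  have "real k * b < 0"
    using Suc.prems k by (simp add: mult_pos_neg)
  then have "real k * b - real a < 0" for a
    by (smt (verit) of_nat_0_le_iff)
  then show ?case using Suc.IH by simp
qed simp

lemma step_cdf_ge_1: "b \<ge> 1 \<Longrightarrow> n \<ge> 1 \<Longrightarrow> step_cdf s n b = f n"
proof (induction s arbitrary: n b)
  case (Suc s)
  have "real k * b - real a \<ge> 1" if "a < k" for a
  proof -
    have "real k * b \<ge> real k"
      using Suc.prems mult_left_mono[of 1 b "real k"] by simp
    moreover have "real a + 1 \<le> real k" using that by simp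
    ultimately show ?thesis by linarith
  qed
  then have "step_cdf (Suc s) n b = (\<Sum>a<k. f (n * k + a)) / \<rho>"
    using Suc append_digit_ge by simp
  then show ?case
    using recursion Suc.prems rho_pos by simp
qed simp

text \<open>Refinement spreads the mass at a left endpoint over points that are not further to the
  left; \<open>recursion\<close> keeps its total.\<close>

lemma step_cdf_Suc_le: "n \<ge> 1 \<Longrightarrow> step_cdf (Suc s) n b \<le> step_cdf s n b"
proof (induction s arbitrary: n b)
  case 0
  show ?case
  proof (cases "b \<ge> 0")
    case True
    have "step_cdf (Suc 0) n b \<le> (\<Sum>a<k. f (n * k + a)) / \<rho>"
      using rho_pos f_nonneg by (auto intro!: divide_right_mono sum_mono)
    also have "\<dots> = f n"
      using recursion 0 rho_pos by simp
    finally show ?thesis using True by simp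
  next
    case False
    then show ?thesis
      using step_cdf_neg[of b "Suc 0" n] by (simp del: step_cdf.simps(2))
  qed
next
  case (Suc s)
  have "step_cdf (Suc (Suc s)) n b = (\<Sum>a<k. step_cdf (Suc s) (n * k + a) (real k * b - real a)) / \<rho>"
    by (subst step_cdf.simps(2)) (rule refl)
  also have "\<dots> \<le> (\<Sum>a<k. step_cdf s (n * k + a) (real k * b - real a)) / \<rho>"
    using rho_pos Suc append_digit_ge by (intro divide_right_mono sum_mono) auto
  finally show ?case by simp
qed

lemma step_cdf_antimono: "n \<ge> 1 \<Longrightarrow> decseq (\<lambda>s. step_cdf s n b)"
  using step_cdf_Suc_le by (auto intro: decseq_SucI simp del: step_cdf.simps)

text \<open>The hypothesis covers suffixes of every length, so it is inherited by the prefixes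
  \<open>g i * k + a\<close>: the digit \<open>a\<close> moves from the suffix to the
  prefix.\<close>

lemma step_cdf_relation:
  assumes "\<And>s r. r < k ^ s \<Longrightarrow> (\<Sum>i\<in>I. c i * f (g i * k ^ s + r)) = 0"
  shows "(\<Sum>i\<in>I. c i * step_cdf s (g i) b) = 0"
  using assms
proof (induction s arbitrary: g b)
  case 0
  have "(\<Sum>i\<in>I. c i * f (g i)) = 0"
    using 0[of 0 0] by simp
  then show ?case by (cases "0 \<le> b") simp_all
next
  case (Suc s)
  have "(\<Sum>i\<in>I. c i * step_cdf s (g i * k + a) b') = 0" if "a < k" for a b'
  proof (rule Suc.IH)
    fix s r assume "r < k ^ s"
    then have "a * k ^ s + r < (a + 1) * k ^ s" by simp
    also have "\<dots> \<le> k ^ Suc s"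
      using that mult_le_mono1[of "a + 1" k "k ^ s"] by simp
    finally have "(\<Sum>i\<in>I. c i * f (g i * k ^ Suc s + (a * k ^ s + r))) = 0"
      by (rule Suc.prems)
    then show "(\<Sum>i\<in>I. c i * f ((g i * k + a) * k ^ s + r)) = 0"
      by (simp add: algebra_simps)
  qed
  then have "(\<Sum>a<k. \<Sum>i\<in>I. c i * step_cdf s (g i * k + a) (real k * b - real a)) = 0"
    by simp
  then have "(\<Sum>i\<in>I. c i * (\<Sum>a<k. step_cdf s (g i * k + a) (real k * b - real a))) = 0"
    by (subst (asm) sum.swap) (simp add: sum_distrib_left)
  then have "(\<Sum>i\<in>I. c i * (\<Sum>a<k. step_cdf s (g i * k + a) (real k * b - real a))) / \<rho> = 0"
    by simp
  then show ?case
    by (subst (asm) sum_divide_distrib) simp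
qed

text \<open>An infimum of monotone right continuous functions is right continuous again, so the
  infimum over \<open>s\<close> can serve as a distribution function.\<close>

definition limit_cdf :: "nat \<Rightarrow> real \<Rightarrow> real" where
  "limit_cdf n b = (INF s. step_cdf s n b)"

lemma bdd_below_step_cdf: "bdd_below (range (\<lambda>s. step_cdf s n b))"
  using step_cdf_nonneg by (auto intro!: bdd_belowI[of _ 0])

lemma step_cdf_tendsto: "n \<ge> 1 \<Longrightarrow> (\<lambda>s. step_cdf s n b) \<longlonglongrightarrow> limit_cdf n b"
  unfolding limit_cdf_def by (intro LIMSEQ_decseq_INF bdd_below_step_cdf step_cdf_antimono)

lemma limit_cdf_le: "limit_cdf n b \<le> step_cdf s n b"
  unfolding limit_cdf_def by (intro cINF_lower bdd_below_step_cdf UNIV_I)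

lemma limit_cdf_mono: "b \<le> c \<Longrightarrow> limit_cdf n b \<le> limit_cdf n c"
  unfolding limit_cdf_def by (intro cINF_mono bdd_below_step_cdf) (auto intro: step_cdf_mono)

lemma limit_cdf_right_cont: "continuous (at_right b) (limit_cdf n)"
  unfolding continuous_within
proof (rule order_tendstoI)
  fix y assume "y < limit_cdf n b"
  then have "y < limit_cdf n c" if "b < c" for c
    using limit_cdf_mono[of b c n] that by simp
  then show "\<forall>\<^sub>F c in at_right b. y < limit_cdf n c"
    by (auto simp: eventually_at_right_field intro!: exI[of _ "b + 1"])
next
  fix y assume "limit_cdf n b < y"
  then obtain s where "step_cdf s n b < y"
    unfolding limit_cdf_def using cINF_less_iff[OF _ bdd_below_step_cdf] by auto
  then have "\<forall>\<^sub>F c in at_right b. step_cdf s n c < y"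
    using step_cdf_right_cont[of b s n] unfolding continuous_within by (rule order_tendstoD(2)[rotated])
  then show "\<forall>\<^sub>F c in at_right b. limit_cdf n c < y"
    by eventually_elim (rule le_less_trans[OF limit_cdf_le])
qed

lemma limit_cdf_neg: "b < 0 \<Longrightarrow> limit_cdf n b = 0"
  by (simp add: limit_cdf_def step_cdf_neg)

lemma limit_cdf_ge_1: "b \<ge> 1 \<Longrightarrow> n \<ge> 1 \<Longrightarrow> limit_cdf n b = f n"
  by (simp add: limit_cdf_def step_cdf_ge_1)

lemma limit_cdf_at_bot: "(limit_cdf n \<longlongrightarrow> 0) at_bot"
  by (rule tendsto_eventually) (auto simp: eventually_at_bot_dense limit_cdf_neg intro!: exI[of _ 0])

lemma limit_cdf_at_top: "n \<ge> 1 \<Longrightarrow> (limit_cdf n \<longlongrightarrow> f n) at_top"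
  by (rule tendsto_eventually) (auto simp: eventually_at_top_linorder limit_cdf_ge_1 intro!: exI[of _ 1])

lemma limit_cdf_recursion:
  assumes "n \<ge> 1"
  shows "limit_cdf n b = (\<Sum>a<k. limit_cdf (n * k + a) (real k * b - real a)) / \<rho>"
proof (rule LIMSEQ_unique)
  show "(\<lambda>s. step_cdf (Suc s) n b) \<longlonglongrightarrow> limit_cdf n b"
    using step_cdf_tendsto[OF assms] by (rule LIMSEQ_Suc)
  show "(\<lambda>s. step_cdf (Suc s) n b) \<longlonglongrightarrow> (\<Sum>a<k. limit_cdf (n * k + a) (real k * b - real a)) / \<rho>"
    using rho_pos append_digit_ge[OF assms] by (auto intro!: tendsto_intros step_cdf_tendsto)
qed

text \<open>For \<open>n \<ge> 1\<close> this is the measure \<open>\<nu>\<^sub>n\<close> of the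
  opening overview. It lives on \<open>[0, 1]\<close>, and mass may collect at the right
  endpoint.\<close>

definition cylinder_measure :: "nat \<Rightarrow> real measure" where
  "cylinder_measure n = interval_measure (limit_cdf n)"

lemma sets_cylinder_measure [measurable_cong, simp]: "sets (cylinder_measure n) = sets borel"
  and space_cylinder_measure [simp]: "space (cylinder_measure n) = UNIV"
  by (simp_all add: cylinder_measure_def)

lemma finite_borel_measure_cylinder_measure: "n \<ge> 1 \<Longrightarrow> finite_borel_measure (cylinder_measure n)"
  unfolding cylinder_measure_def
  using finite_borel_measure_interval_measure limit_cdf_mono limit_cdf_right_cont limit_cdf_at_bot
    limit_cdf_at_top f_nonneg by metis

lemma measure_cylinder_measure_atMost: "measure (cylinder_measure n) {..b} = limit_cdf n b"
  unfolding cylinder_measure_def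
  by (intro measure_interval_measure_Iic limit_cdf_mono limit_cdf_right_cont limit_cdf_at_bot)

lemma measure_cylinder_measure_UNIV: "n \<ge> 1 \<Longrightarrow> measure (cylinder_measure n) UNIV = f n"
  unfolding cylinder_measure_def measure_def
  by (subst interval_measure_UNIV[OF limit_cdf_mono limit_cdf_right_cont limit_cdf_at_bot limit_cdf_at_top])
    (auto simp: f_nonneg)

lemma cylinder_measure_self_similar:
  assumes n: "n \<ge> 1" and E: "E \<in> sets borel"
  shows "measure (cylinder_measure n) E =
    (\<Sum>a<k. measure (cylinder_measure (n * k + a)) {t. (real a + t) / real k \<in> E}) / \<rho>"
proof (rule affine_combination_borel)
  fix b
  show "measure (cylinder_measure n) {..b} =
      (\<Sum>a<k. measure (cylinder_measure (n * k + a)) {..real k * b - real a}) / \<rho>"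
    by (simp add: measure_cylinder_measure_atMost limit_cdf_recursion[OF n])
qed (use k E rho_pos n append_digit_ge[OF n] finite_borel_measure_cylinder_measure in auto)

text \<open>Supplies the hypothesis \<open>rel\<close> of \<open>proportional_to_sequence\<close>
  for the masses of a fixed Borel set.\<close>

lemma cylinder_measure_relation:
  assumes "finite I" "\<And>i. i \<in> I \<Longrightarrow> g i \<ge> 1"
    and rel: "\<And>s r. r < k ^ s \<Longrightarrow> (\<Sum>i\<in>I. c i * f (g i * k ^ s + r)) = 0"
    and E: "E \<in> sets borel"
  shows "(\<Sum>i\<in>I. c i * measure (cylinder_measure (g i)) E) = 0"
proof (rule linear_relation_borel[OF assms(1) _ _ E])
  fix b
  have "(\<lambda>s. \<Sum>i\<in>I. c i * step_cdf s (g i) b) \<longlonglongrightarrow> (\<Sum>i\<in>I. c i * limit_cdf (g i) b)"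
    using assms(2) by (intro tendsto_sum tendsto_mult_left step_cdf_tendsto)
  then show "(\<Sum>i\<in>I. c i * measure (cylinder_measure (g i)) {..b}) = 0"
    using step_cdf_relation[OF rel]
    by (simp add: measure_cylinder_measure_atMost LIMSEQ_const_iff)
qed (use assms(2) finite_borel_measure_cylinder_measure in auto)

text \<open>By invariance, the part of \<open>cylinder_measure n\<close> in \<open>E\<close>
  inherits the self-similarity and hence follows the recursion of \<open>step_cdf\<close>. At depth
  0 the bound is just the assumed mass \<open>c * f n\<close> of \<open>E\<close>; letting
  \<open>s\<close> grow turns \<open>step_cdf\<close> into \<open>limit_cdf\<close>.\<close>

lemma invariant_part_le:
  assumes E: "E \<in> sets borel" and inv: "\<And>a t. a < k \<Longrightarrow> (real a + t) / real k \<in> E \<longleftrightarrow> t \<in> E"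
    and c: "\<And>n. n \<ge> 1 \<Longrightarrow> measure (cylinder_measure n) E = c * f n" and n: "n \<ge> 1"
  shows "measure (cylinder_measure n) ({..b} \<inter> E) \<le> c * limit_cdf n b"
proof -
  have "measure (cylinder_measure n) ({..b} \<inter> E) \<le> c * step_cdf s n b" for s
    using n
  proof (induction s arbitrary: n b)
    case 0
    interpret finite_borel_measure "cylinder_measure n"
      using 0 by (rule finite_borel_measure_cylinder_measure)
    show ?case
    proof (cases "b \<ge> 0")
      case True
      have "measure (cylinder_measure n) ({..b} \<inter> E) \<le> measure (cylinder_measure n) E"
        using E by (intro finite_measure_mono) auto
      then show ?thesis using True c[OF 0] by simp
    next
      case False
      have "measure (cylinder_measure n) ({..b} \<inter> E) \<le> measure (cylinder_measure n) {..b}"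
        using E by (intro finite_measure_mono) auto
      then show ?thesis
        using False limit_cdf_neg by (simp add: measure_cylinder_measure_atMost)
    qed
  next
    case (Suc s)
    have "measure (cylinder_measure n) ({..b} \<inter> E) =
      (\<Sum>a<k. measure (cylinder_measure (n * k + a)) {t. (real a + t) / real k \<in> {..b} \<inter> E}) / \<rho>"
      using E by (intro cylinder_measure_self_similar Suc.prems) auto
    also have "\<dots> = (\<Sum>a<k. measure (cylinder_measure (n * k + a)) ({..real k * b - real a} \<inter> E)) / \<rho>"
    proof -
      have "{t. (real a + t) / real k \<in> {..b} \<inter> E} = {..real k * b - real a} \<inter> E" if "a < k" for a
        using k inv[OF that] by (auto simp: field_simps)
      then show ?thesis by simp
    qed
    also have "\<dots> \<le> (\<Sum>a<k. c * step_cdf s (n * k + a) (real k * b - real a)) / \<rho>"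
      using rho_pos Suc.IH append_digit_ge[OF Suc.prems] by (intro divide_right_mono sum_mono) auto
    finally show ?case
      by (simp add: sum_distrib_left)
  qed
  moreover have "(\<lambda>s. c * step_cdf s n b) \<longlonglongrightarrow> c * limit_cdf n b"
    by (intro tendsto_intros step_cdf_tendsto n)
  ultimately show ?thesis
    by (intro LIMSEQ_le_const) auto
qed

lemma invariant_zero_one:
  assumes E: "E \<in> sets borel" and inv: "\<And>a t. a < k \<Longrightarrow> (real a + t) / real k \<in> E \<longleftrightarrow> t \<in> E"
    and c: "\<And>n. n \<ge> 1 \<Longrightarrow> measure (cylinder_measure n) E = c * f n"
  shows "(\<forall>n\<ge>1. measure (cylinder_measure n) E = 0) \<or> (\<forall>n\<ge>1. measure (cylinder_measure n) (- E) = 0)"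
proof -
  have compl: "measure (cylinder_measure n) (- E) = (1 - c) * f n" if n: "n \<ge> 1" for n
  proof -
    interpret finite_borel_measure "cylinder_measure n"
      using n by (rule finite_borel_measure_cylinder_measure)
    show ?thesis
      using finite_measure_compl[of E] E c[OF n] measure_cylinder_measure_UNIV[OF n]
      by (simp add: Compl_eq_Diff_UNIV left_diff_distrib)
  qed
  have square: "c * f n = c * (c * f n)" if n: "n \<ge> 1" for n
  proof -
    interpret finite_borel_measure "cylinder_measure n"
      using n by (rule finite_borel_measure_cylinder_measure)
    \<comment> \<open>The upper bounds for \<open>E\<close> and for \<open>- E\<close> add up to the
      mass of the half-line, so both are equalities.\<close>
    have atMost: "measure (cylinder_measure n) ({..b} \<inter> E) = c * limit_cdf n b" for b
    proof -
      have "limit_cdf n b = measure (cylinder_measure n) ({..b} \<inter> E \<union> {..b} \<inter> - E)"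
        by (simp add: Int_Un_distrib[symmetric] measure_cylinder_measure_atMost)
      also have "\<dots> = measure (cylinder_measure n) ({..b} \<inter> E) + measure (cylinder_measure n) ({..b} \<inter> - E)"
        using E by (intro finite_measure_Union) auto
      finally have "limit_cdf n b = measure (cylinder_measure n) ({..b} \<inter> E) + measure (cylinder_measure n) ({..b} \<inter> - E)" .
      moreover have "measure (cylinder_measure n) ({..b} \<inter> E) \<le> c * limit_cdf n b"
        by (intro invariant_part_le E inv c n)
      moreover have "measure (cylinder_measure n) ({..b} \<inter> - E) \<le> (1 - c) * limit_cdf n b"
        using E inv by (intro invariant_part_le compl n) auto
      ultimately show ?thesis
        by (simp add: left_diff_distrib)
    qed
    \<comment> \<open>\<open>M True\<close> is the restriction to \<open>E\<close>,
      \<open>M False\<close> the whole measure. The proportion \<open>c\<close> between them extends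
      from half-lines to Borel sets and is evaluated at \<open>E\<close> itself.\<close>
    define M where "M i = (if i then density (cylinder_measure n) (indicator E) else cylinder_measure n)" for i
    have M: "measure (M True) A = measure (cylinder_measure n) (A \<inter> E)" if "A \<in> sets borel" for A
      using that E by (simp add: M_def measure_restricted Int_commute)
    have "(\<Sum>i\<in>UNIV. (if i then 1 else - c) * measure (M i) E) = 0"
    proof (rule linear_relation_borel[OF _ _ _ E])
      fix i
      show "finite_borel_measure (M i)"
        using finite_measure_restricted[of E] E finite_borel_measure_axioms
        by (auto simp: M_def finite_borel_measure_def finite_borel_measure_axioms_def)
    qed (use M atMost in \<open>simp_all add: UNIV_bool M_def[of False] measure_cylinder_measure_atMost\<close>)
    then show ?thesis
      using M[OF E] c[OF n] by (simp add: UNIV_bool M_def[of False])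
  qed
  \<comment> \<open>A single nonzero weight decides \<open>c\<close>; if all weights vanish, so do
    all the masses.\<close>
  have "c = 0 \<or> c = 1" if "n \<ge> 1" "f n \<noteq> 0" for n
    using square[OF that(1)] that(2) by simp
  then consider "c = 0" | "c = 1" | "\<forall>n\<ge>1. f n = 0"
    by blast
  then show ?thesis
    by cases (simp_all add: c compl)
qed

end

section \<open>The ghost measure\<close>

lemma sum_lessThan_mult:
  "(\<Sum>a<n. \<Sum>r<m. h (a * m + r)) = (\<Sum>q<n * m. h q)" for m n :: nat
proof -
  have "(\<Sum>r<m. h (a * m + r)) = sum h {a * m..<a * m + m}" for a
    using sum.shift_bounds_nat_ivl[of h 0 "a * m" m] by (simp add: add.commute atLeast0LessThan)
  then show ?thesis
    by (simp add: sum.nat_group)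
qed

context digit_weights
begin

text \<open>Unfolds the recursion: the first digit \<open>a\<close> and the remaining suffix
  \<open>r\<close> combine to the suffix \<open>a * k ^ s + r\<close>.\<close>

lemma step_cdf_eq:
  "step_cdf s n b = (\<Sum>r<k ^ s. if real r \<le> b * real k ^ s then f (n * k ^ s + r) else 0) / \<rho> ^ s"
proof (induction s arbitrary: n b)
  case (Suc s)
  define h where "h q = (if real q \<le> b * real k ^ Suc s then f (n * k ^ Suc s + q) else 0)" for q
  have "(if real r \<le> (real k * b - real a) * real k ^ s then f ((n * k + a) * k ^ s + r) else 0) =
      h (a * k ^ s + r)" for a r
    by (simp add: h_def algebra_simps)
  then have "step_cdf (Suc s) n b = (\<Sum>a<k. (\<Sum>r<k ^ s. h (a * k ^ s + r)) / \<rho> ^ s) / \<rho>"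
    by (simp add: Suc.IH)
  also have "\<dots> = (\<Sum>q<k ^ Suc s. h q) / \<rho> ^ Suc s"
    by (simp add: sum_divide_distrib[symmetric] sum_lessThan_mult mult.commute)
  finally show ?case
    by (simp add: h_def)
qed simp

text \<open>The block consists of the integers with leading digit \<open>Suc j\<close> and
  \<open>N\<close> further digits. Since \<open>k ^ N + (j * k ^ N + r) = Suc j * k ^ N + r\<close>,
  the offset \<open>m = j * k ^ N + r\<close> runs through them in order.\<close>

lemma block_cdf_eq:
  "(\<Sum>j<k - 1. step_cdf N (Suc j) (real (k - 1) * b - real j)) =
    (\<Sum>m<(k - 1) * k ^ N. if real m \<le> b * (real (k - 1) * real k ^ N) then f (k ^ N + m) else 0) / \<rho> ^ N"
proof -
  define h where "h m = (if real m \<le> b * (real (k - 1) * real k ^ N) then f (k ^ N + m) else 0)" for m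
  have "(if real r \<le> (real (k - 1) * b - real j) * real k ^ N then f (Suc j * k ^ N + r) else 0) =
      h (j * k ^ N + r)" for j r
    by (simp add: h_def algebra_simps)
  then have "(\<Sum>j<k - 1. step_cdf N (Suc j) (real (k - 1) * b - real j)) =
      (\<Sum>j<k - 1. (\<Sum>r<k ^ N. h (j * k ^ N + r)) / \<rho> ^ N)"
    by (simp only: step_cdf_eq)
  also have "\<dots> = (\<Sum>m<(k - 1) * k ^ N. h m) / \<rho> ^ N"
    by (simp only: sum_divide_distrib[symmetric] sum_lessThan_mult)
  finally show ?thesis
    by (simp only: h_def)
qed

end

section \<open>The ghost measure on the line\<close>

locale block_weights = digit_weights +
  assumes block_sum: "\<And>N. block_sum k f N = \<rho> ^ N"
begin

text \<open>Distribution function of the sum of the images of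
  \<open>cylinder_measure (Suc j)\<close> under \<open>t \<mapsto> (j + t) / (k - 1)\<close>: each
  leading digit occupies an interval of length \<open>1 / (k - 1)\<close>.\<close>

definition ghost_cdf :: "real \<Rightarrow> real" where
  "ghost_cdf b = (\<Sum>j<k - 1. limit_cdf (Suc j) (real (k - 1) * b - real j))"

definition line_ghost :: "real measure" where
  "line_ghost = interval_measure ghost_cdf"

text \<open>Block 0 consists of the single nonzero digits. Its sum \<open>\<rho> ^ 0\<close>
  normalises the total mass of the ghost measure.\<close>

lemma sum_leading_digits: "(\<Sum>j<k - 1. f (Suc j)) = 1"
  using block_sum[of 0] sum.shift_bounds_nat_ivl[of f 0 1 "k - 1"] k
  by (simp add: block_sum_def atLeast0LessThan)

lemma ghost_cdf_mono: "b \<le> c \<Longrightarrow> ghost_cdf b \<le> ghost_cdf c"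
  unfolding ghost_cdf_def by (intro sum_mono limit_cdf_mono diff_right_mono mult_left_mono) auto

lemma ghost_cdf_right_cont: "continuous (at_right b) ghost_cdf"
proof -
  have "((\<lambda>c. limit_cdf (Suc j) (real (k - 1) * c - real j)) \<longlongrightarrow>
      limit_cdf (Suc j) (real (k - 1) * b - real j)) (at_right b)" for j
  proof -
    have "filterlim (\<lambda>c. real (k - 1) * c - real j) (at_right (real (k - 1) * b - real j)) (at_right b)"
      using k by (auto simp: filterlim_at intro!: tendsto_intros eventually_at_rightI[of b "b + 1"])
    then show ?thesis
      using limit_cdf_right_cont[of "real (k - 1) * b - real j" "Suc j"] unfolding continuous_within
      by (rule filterlim_compose[rotated])
  qed
  then show ?thesis
    unfolding continuous_within ghost_cdf_def by (intro tendsto_sum)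
qed

lemma ghost_cdf_at_bot: "(ghost_cdf \<longlongrightarrow> 0) at_bot"
proof (rule tendsto_eventually, unfold eventually_at_bot_dense, intro exI allI impI)
  fix b :: real assume "b < 0"
  then have "real (k - 1) * b < 0"
    using k by (intro mult_pos_neg) auto
  then have "real (k - 1) * b - real j < 0" for j
    by (smt (verit) of_nat_0_le_iff)
  then show "ghost_cdf b = 0"
    unfolding ghost_cdf_def by (intro sum.neutral ballI limit_cdf_neg)
qed

lemma ghost_cdf_at_top: "(ghost_cdf \<longlongrightarrow> 1) at_top"
proof (rule tendsto_eventually, unfold eventually_at_top_linorder, intro exI allI impI)
  fix b :: real assume "b \<ge> 1"
  then have "real (k - 1) * b \<ge> real (k - 1)"
    using mult_left_mono[of 1 b "real (k - 1)"] by simp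
  then have ge: "real (k - 1) * b - real j \<ge> 1" if "j < k - 1" for j
    using that by linarith
  have "ghost_cdf b = (\<Sum>j<k - 1. f (Suc j))"
    unfolding ghost_cdf_def by (intro sum.cong refl limit_cdf_ge_1 ge) simp_all
  then show "ghost_cdf b = 1"
    by (simp only: sum_leading_digits)
qed

lemma real_distribution_line_ghost: "real_distribution line_ghost"
  unfolding line_ghost_def
  by (intro real_distribution_interval_measure ghost_cdf_mono ghost_cdf_right_cont
      ghost_cdf_at_bot ghost_cdf_at_top)

lemma measure_line_ghost_atMost: "measure line_ghost {..b} = ghost_cdf b"
  unfolding line_ghost_def
  by (intro measure_interval_measure_Iic ghost_cdf_mono ghost_cdf_right_cont ghost_cdf_at_bot)

text \<open>The divisor 1 is the \<open>\<rho>\<close> of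
  \<open>affine_combination_borel\<close>.\<close>

lemma line_ghost_decomposition:
  assumes E: "E \<in> sets borel"
  shows "measure line_ghost E =
    (\<Sum>j<k - 1. measure (cylinder_measure (Suc j)) {t. (real j + t) / real (k - 1) \<in> E}) / 1"
proof (rule affine_combination_borel)
  show "finite_borel_measure line_ghost"
    using real_distribution_line_ghost by (rule real_distribution.finite_borel_measure_M)
  show "measure line_ghost {..b} =
      (\<Sum>j<k - 1. measure (cylinder_measure (Suc j)) {..real (k - 1) * b - real j}) / 1" for b
    by (simp add: measure_line_ghost_atMost measure_cylinder_measure_atMost ghost_cdf_def)
qed (use k E finite_borel_measure_cylinder_measure in auto)

text \<open>The weighted index set is kept apart so that it can be mapped both to the torus and to
  the line.\<close>

definition block_points :: "nat \<Rightarrow> nat measure" where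
  "block_points N = point_measure {0 ..< k ^ (N + 1) - k ^ N}
     (\<lambda>m. ennreal (f (k ^ N + m) / block_sum k f N))"

definition block_position :: "nat \<Rightarrow> nat \<Rightarrow> real" where
  "block_position N m = real m / (real k ^ N * (real k - 1))"

lemma block_measure_eq: "block_measure k f N = distr (block_points N) torus_borel (block_position N)"
  by (simp add: block_measure_def block_points_def block_position_def[abs_def])

lemma block_length: "k ^ (N + 1) - k ^ N = (k - 1) * k ^ N"
  by (simp add: diff_mult_distrib)

lemma measure_block_points:
  assumes "A \<subseteq> {..<(k - 1) * k ^ N}"
  shows "measure (block_points N) A = (\<Sum>m\<in>A. f (k ^ N + m)) / \<rho> ^ N"
proof -
  have "emeasure (block_points N) A = (\<Sum>m\<in>A. ennreal (f (k ^ N + m) / \<rho> ^ N))"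
    unfolding block_points_def block_sum block_length
    using assms by (intro emeasure_point_measure_finite) auto
  also have "\<dots> = ennreal (\<Sum>m\<in>A. f (k ^ N + m) / \<rho> ^ N)"
    using f_nonneg rho_pos by (intro sum_ennreal) auto
  finally show ?thesis
    using f_nonneg rho_pos by (simp add: measure_def sum_divide_distrib sum_nonneg)
qed

lemma space_block_points: "space (block_points N) = {..<(k - 1) * k ^ N}"
  unfolding block_points_def block_length by (simp add: space_point_measure atLeast0LessThan)

lemma prob_space_block_points: "prob_space (block_points N)"
proof (rule prob_spaceI)
  let ?A = "{..<(k - 1) * k ^ N}"
  have "emeasure (block_points N) ?A = (\<Sum>m\<in>?A. ennreal (f (k ^ N + m) / \<rho> ^ N))"
    unfolding block_points_def block_sum block_length
    by (intro emeasure_point_measure_finite) auto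
  also have "\<dots> = ennreal (\<Sum>m\<in>?A. f (k ^ N + m) / \<rho> ^ N)"
    using f_nonneg rho_pos by (intro sum_ennreal) auto
  also have "(\<Sum>m\<in>?A. f (k ^ N + m) / \<rho> ^ N) = (\<Sum>m\<in>?A. f (k ^ N + m)) / \<rho> ^ N"
    by (simp add: sum_divide_distrib)
  also have "(\<Sum>m\<in>?A. f (k ^ N + m)) = block_sum k f N"
    using sum.shift_bounds_nat_ivl[of f 0 "k ^ N" "(k - 1) * k ^ N"] k
    by (simp add: block_sum_def add.commute atLeast0LessThan diff_mult_distrib)
  finally show "emeasure (block_points N) (space (block_points N)) = 1"
    using block_sum rho_pos by (simp add: space_block_points)
qed

lemma block_position_bounds:
  assumes "m < (k - 1) * k ^ N"
  shows "block_position N m \<in> {0..<1}"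
proof -
  have "real m < real ((k - 1) * k ^ N)"
    using assms by (simp only: of_nat_less_iff)
  then have "real m < real k ^ N * (real k - 1)"
    using k by (simp add: of_nat_diff mult.commute)
  then show ?thesis
    using k by (simp add: block_position_def)
qed

lemma measurable_block_position:
  "block_position N \<in> measurable (block_points N) torus_borel"
  "block_position N \<in> measurable (block_points N) borel"
proof -
  have "g \<in> measurable (block_points N) M" if "g \<in> space (block_points N) \<rightarrow> space M"
    for g and M :: "real measure"
    using that by (simp add: block_points_def measurable_point_measure_eq1 space_point_measure)
  then show "block_position N \<in> measurable (block_points N) torus_borel"
    "block_position N \<in> measurable (block_points N) borel"
    using block_position_bounds
    by (auto simp: space_block_points torus_borel_def space_restrict_space)
qed

definition line_block :: "nat \<Rightarrow> real measure" where
  "line_block N = distr (block_points N) borel (block_position N)"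

lemma real_distribution_line_block: "real_distribution (line_block N)"
  unfolding line_block_def
  by (intro prob_space.real_distribution_distr prob_space_block_points measurable_block_position)

lemma cdf_line_block:
  "cdf (line_block N) b = (\<Sum>j<k - 1. step_cdf N (Suc j) (real (k - 1) * b - real j))"
proof -
  let ?S = "{m. m < (k - 1) * k ^ N \<and> real m \<le> b * (real (k - 1) * real k ^ N)}"
  have "block_position N m \<le> b \<longleftrightarrow> real m \<le> b * (real (k - 1) * real k ^ N)" for m
    using k by (simp add: block_position_def of_nat_diff pos_divide_le_eq mult.commute)
  then have S: "block_position N -` {..b} \<inter> space (block_points N) = ?S"
    by (auto simp: space_block_points)
  have "cdf (line_block N) b = measure (block_points N) ?S"
    unfolding cdf_def line_block_def by (subst measure_distr) (simp_all add: measurable_block_position S)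
  also have "\<dots> = (\<Sum>m\<in>?S. f (k ^ N + m)) / \<rho> ^ N"
    by (rule measure_block_points) auto
  also have "(\<Sum>m\<in>?S. f (k ^ N + m)) =
      (\<Sum>m<(k - 1) * k ^ N. if real m \<le> b * (real (k - 1) * real k ^ N) then f (k ^ N + m) else 0)"
    by (simp add: sum.If_cases) (auto intro!: sum.cong)
  finally show ?thesis
    by (simp only: block_cdf_eq)
qed

text \<open>The distribution functions converge at every point, not only at continuity points,
  because \<open>step_cdf\<close> tends to \<open>limit_cdf\<close> everywhere.\<close>

lemma weak_conv_line_block: "weak_conv_m line_block line_ghost"
proof -
  have "(\<lambda>N. cdf (line_block N) b) \<longlonglongrightarrow> cdf line_ghost b" for b
    unfolding cdf_line_block cdf_def[of line_ghost] measure_line_ghost_atMost ghost_cdf_def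
    by (intro tendsto_sum step_cdf_tendsto) simp
  then show ?thesis
    by (simp add: weak_conv_m_def weak_conv_def)
qed

text \<open>The limit on the line may have an atom at 1; \<open>frac\<close> moves it to 0, as the
  identification of the endpoints demands.\<close>

definition torus_ghost :: "real measure" where
  "torus_ghost = distr line_ghost torus_borel frac"

end

section \<open>From the line to the torus\<close>

lemma measurable_frac_torus: "frac \<in> measurable borel torus_borel"
proof -
  have "(\<lambda>t::real. t - of_int \<lfloor>t\<rfloor>) \<in> borel_measurable borel"
    by measurable
  then have "(frac :: real \<Rightarrow> real) \<in> borel_measurable borel"
    by (simp add: frac_def[abs_def])
  then show ?thesis
    unfolding torus_borel_def by (intro measurable_restrict_space2) (auto simp: frac_lt_1)
qed

lemma torus_continuous_add_int:
  assumes "g \<in> torus_continuous"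
  shows "g (t + of_int z) = g t"
proof -
  have p: "g (s + 1) = g s" for s
    using assms by (simp add: torus_continuous_def)
  have n: "g (s + real n) = g s" for s n
  proof (induction n)
    case (Suc n)
    have "s + real (Suc n) = (s + real n) + 1" by simp
    then show ?case using p[of "s + real n"] Suc by (simp only:)
  qed simp
  show ?thesis
  proof (cases z)
    case (nonneg n)
    then show ?thesis using n by simp
  next
    case (neg n)
    then have z: "t + of_int z = t - real (Suc n)" by simp
    show ?thesis
      using n[of "t - real (Suc n)" "Suc n"] unfolding z by (simp only: diff_add_cancel)
  qed
qed

lemma torus_continuous_frac:
  assumes "g \<in> torus_continuous"
  shows "g (frac t) = g t"
  using torus_continuous_add_int[OF assms, of t "- \<lfloor>t\<rfloor>"] by (simp add: frac_def)

lemma torus_continuous_bounded: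
  assumes "g \<in> torus_continuous"
  obtains C where "\<And>t. norm (g t) \<le> C"
proof -
  have "continuous_on {0..1} g"
    using assms by (auto simp: torus_continuous_def intro: continuous_on_subset)
  then have "bounded (g ` {0..1})"
    by (intro compact_imp_bounded compact_continuous_image) auto
  then obtain C where C: "\<forall>x\<in>g ` {0..1}. norm x \<le> C"
    unfolding bounded_iff by blast
  have "norm (g t) \<le> C" for t
  proof -
    have "frac t \<in> {0..1}"
      using frac_lt_1[of t] by simp
    then have "norm (g (frac t)) \<le> C"
      using C by blast
    then show ?thesis
      by (simp only: torus_continuous_frac[OF assms])
  qed
  then show thesis using that by blast
qed

context block_weights
begin

lemma measurable_frac_line_ghost: "frac \<in> measurable line_ghost torus_borel"
  using measurable_frac_torus real_distribution.events_eq_borel[OF real_distribution_line_ghost]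
  by (simp cong: measurable_cong_sets)

text \<open>Weak convergence on the line suffices: a continuous periodic function is bounded and
  does not see the reduction by \<open>frac\<close>.\<close>

lemma torus_continuous_integral_tendsto:
  assumes "g \<in> torus_continuous"
  shows "(\<lambda>N. \<integral>t. g t \<partial>block_measure k f N) \<longlonglongrightarrow> (\<integral>t. g t \<partial>torus_ghost)"
proof -
  have cont: "continuous_on UNIV g"
    using assms by (simp add: torus_continuous_def)
  then have g: "g \<in> borel_measurable borel"
    by (rule borel_measurable_continuous_onI)
  then have g': "g \<in> borel_measurable torus_borel"
    unfolding torus_borel_def by (rule measurable_restrict_space1)
  obtain C where "\<And>t. norm (g t) \<le> C"
    using torus_continuous_bounded[OF assms] by blast
  then have "(\<lambda>N. integral\<^sup>L (line_block N) g) \<longlonglongrightarrow> integral\<^sup>L line_ghost g"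
    using cont
    by (intro weak_conv_imp_integral_bdd_continuous_conv real_distribution_line_block
        real_distribution_line_ghost weak_conv_line_block)
      (auto simp: continuous_on_eq_continuous_at)
  moreover have "integral\<^sup>L (line_block N) g = integral\<^sup>L (block_measure k f N) g" for N
    unfolding line_block_def block_measure_eq
    by (simp add: integral_distr measurable_block_position g g')
  moreover have "integral\<^sup>L torus_ghost g = integral\<^sup>L line_ghost g"
    unfolding torus_ghost_def
    by (simp add: integral_distr measurable_frac_line_ghost g' torus_continuous_frac[OF assms])
  ultimately show ?thesis by simp
qed

lemma prob_space_torus_ghost: "prob_space torus_ghost"
  unfolding torus_ghost_def
  using real_distribution_line_ghost measurable_frac_line_ghost
  by (intro prob_space.prob_space_distr) (simp_all add: real_distribution_def)

lemma sets_torus_ghost: "sets torus_ghost = sets torus_borel"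
  by (simp add: torus_ghost_def)

text \<open>The integrals converge along the whole sequence, so each neighbourhood condition holds
  eventually, and thus infinitely often.\<close>

lemma ghost_measure_torus_ghost: "ghost_measure k f torus_ghost"
  unfolding ghost_measure_def
proof (intro conjI prob_space_torus_ghost sets_torus_ghost allI impI)
  fix G :: "(real \<Rightarrow> real) set" and \<epsilon> :: real
  assume *: "finite G \<and> G \<subseteq> torus_continuous \<and> \<epsilon> > 0"
  have "\<forall>\<^sub>F N in sequentially. \<bar>(\<integral>t. g t \<partial>block_measure k f N) - (\<integral>t. g t \<partial>torus_ghost)\<bar> < \<epsilon>"
    if "g \<in> G" for g
    using tendstoD[OF torus_continuous_integral_tendsto[of g], of \<epsilon>] * that
    by (auto simp: dist_real_def)
  then have "\<forall>\<^sub>F N in sequentially. \<forall>g\<in>G.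
      \<bar>(\<integral>t. g t \<partial>block_measure k f N) - (\<integral>t. g t \<partial>torus_ghost)\<bar> < \<epsilon>"
    using * by (intro eventually_ball_finite) auto
  then have "\<forall>\<^sub>F N in sequentially. block_sum k f N \<noteq> 0 \<and>
      (\<forall>g\<in>G. \<bar>(\<integral>t. g t \<partial>block_measure k f N) - (\<integral>t. g t \<partial>torus_ghost)\<bar> < \<epsilon>)"
    using rho_pos by (simp add: block_sum)
  then show "\<exists>\<^sub>F N in sequentially. block_sum k f N \<noteq> 0 \<and>
      (\<forall>g\<in>G. \<bar>(\<integral>t. g t \<partial>block_measure k f N) - (\<integral>t. g t \<partial>torus_ghost)\<bar> < \<epsilon>)"
    by (rule eventually_frequently[OF sequentially_bot])
qed

end

text \<open>These maps include the digit maps \<open>(a + t) / k\<close>, the placement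
  \<open>(j + t) / (k - 1)\<close> of leading digits and the integer translations. There are only
  countably many, so orbits of countable sets stay countable and orbits of null sets stay
  null.\<close>

definition rational_affine_invariant :: "real set \<Rightarrow> bool" where
  "rational_affine_invariant E \<longleftrightarrow>
     (\<forall>p\<in>\<rat>. \<forall>q\<in>\<rat>. \<forall>t. p \<noteq> 0 \<longrightarrow> (p * t + q \<in> E \<longleftrightarrow> t \<in> E))"

lemma rational_affine_invariant_compl:
  "rational_affine_invariant E \<Longrightarrow> rational_affine_invariant (- E)"
  by (simp add: rational_affine_invariant_def)

lemma rational_affine_invariantD:
  assumes "rational_affine_invariant E" "k > 0"
  shows "(real a + t) / real k \<in> E \<longleftrightarrow> t \<in> E"
proof -
  have "1 / real k * t + real a / real k \<in> E \<longleftrightarrow> t \<in> E"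
    using assms(2)
    by (intro assms(1)[unfolded rational_affine_invariant_def, rule_format]) (auto intro: Rats_divide)
  moreover have "1 / real k * t + real a / real k = (real a + t) / real k"
    by (simp add: add_divide_distrib)
  ultimately show ?thesis by simp
qed

context block_weights
begin

text \<open>Invariance absorbs both the reduction modulo 1 and the affine maps of
  \<open>line_ghost_decomposition\<close>.\<close>

lemma torus_ghost_invariant:
  assumes E: "E \<in> sets borel" and inv: "rational_affine_invariant E"
  shows "measure torus_ghost (E \<inter> {0..<1}) = (\<Sum>j<k - 1. measure (cylinder_measure (Suc j)) E)"
proof -
  have "frac t \<in> E \<longleftrightarrow> t \<in> E" for t
    using inv unfolding rational_affine_invariant_def frac_def
    by (metis Rats_1 Rats_minus_iff Rats_of_int mult_1 one_neq_zero uminus_add_conv_diff add.commute)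
  then have "frac -` (E \<inter> {0..<1}) \<inter> space line_ghost = E"
    using real_distribution.space_eq_univ[OF real_distribution_line_ghost] by (auto simp: frac_lt_1)
  moreover have "E \<inter> {0..<1} \<in> sets torus_borel"
    using E by (auto simp: torus_borel_def sets_restrict_space_iff)
  ultimately have "measure torus_ghost (E \<inter> {0..<1}) = measure line_ghost E"
    unfolding torus_ghost_def by (subst measure_distr[OF measurable_frac_line_ghost]) auto
  also have "\<dots> = (\<Sum>j<k - 1. measure (cylinder_measure (Suc j)) E)"
    using line_ghost_decomposition[OF E] rational_affine_invariantD[OF inv, of "k - 1"] k by simp
  finally show ?thesis .
qed

lemma torus_ghost_zero_one:
  assumes E: "E \<in> sets borel" and inv: "rational_affine_invariant E"
    and c: "\<And>n. n \<ge> 1 \<Longrightarrow> measure (cylinder_measure n) E = c * f n"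
  shows "measure torus_ghost (E \<inter> {0..<1}) = 0 \<or> measure torus_ghost ({0..<1} - E) = 0"
proof -
  have "(\<forall>n\<ge>1. measure (cylinder_measure n) E = 0) \<or> (\<forall>n\<ge>1. measure (cylinder_measure n) (- E) = 0)"
    using rational_affine_invariantD[OF inv] k by (intro invariant_zero_one[OF E _ c]) auto
  moreover have "{0..<1} - E = - E \<inter> {0..<1}" by auto
  ultimately show ?thesis
    using torus_ghost_invariant[OF E inv] E
      torus_ghost_invariant[OF _ rational_affine_invariant_compl[OF inv]] by auto
qed

end

section \<open>Spectral purity\<close>

lemma space_torus_borel: "space torus_borel = {0..<1}"
  by (simp add: torus_borel_def space_restrict_space)

lemma sets_torus_borel: "sets torus_borel = {E \<in> sets borel. E \<subseteq> {0..<1}}"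
  by (rule set_eqI) (simp add: torus_borel_def sets_restrict_space_iff conj_commute)

lemma null_sets_torus_lebesgue:
  "E \<in> null_sets torus_lebesgue \<longleftrightarrow> E \<subseteq> {0..<1} \<and> E \<in> null_sets lborel"
  by (auto simp: torus_lebesgue_def null_sets_restrict_space)

lemma countable_null_sets_torus_lebesgue:
  "countable C \<Longrightarrow> C \<subseteq> {0..<1} \<Longrightarrow> C \<in> null_sets torus_lebesgue"
  by (simp add: null_sets_torus_lebesgue countable_imp_null_set_lborel)

section \<open>Lebesgue decompositions of pure measures\<close>

lemma pure_point_null_measure: "pure_point (null_measure M)"
  by (auto simp: pure_point_def intro!: exI[of _ "{}"])

lemma singular_continuous_null_measure: "singular_continuous (null_measure M)"
  by (auto simp: singular_continuous_def intro!: bexI[of _ "{}"])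

lemma absolutely_continuous_null_measure:
  "sets M = sets torus_lebesgue \<Longrightarrow> absolutely_continuous torus_lebesgue (null_measure M)"
  by (auto simp: absolutely_continuous_def null_sets_def)

lemma lebesgue_decompositionD:
  assumes "lebesgue_decomposition M P S A"
  shows "sets P = sets M" "sets S = sets M" "sets A = sets M"
    and "space P = space M" "space S = space M"
    and "\<And>E. E \<in> sets M \<Longrightarrow> emeasure M E = emeasure P E + emeasure S E + emeasure A E"
    and "pure_point P" "singular_continuous S" "absolutely_continuous torus_lebesgue A"
  using assms sets_eq_imp_space_eq unfolding lebesgue_decomposition_def by blast+

context
  fixes M :: "real measure"
  assumes sets: "sets M = sets torus_borel"
begin

lemma space_eq: "space M = {0..<1}"
  using sets_eq_imp_space_eq[OF sets] space_torus_borel by simp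

lemma decomposition_null:
  assumes "lebesgue_decomposition M P S A" "E \<in> sets M" "emeasure M E = 0"
  shows "emeasure P E = 0" "emeasure S E = 0" "emeasure A E = 0"
  using lebesgue_decompositionD(6)[OF assms(1,2)] assms(3) by simp_all

lemma decomposition_countable:
  assumes d: "lebesgue_decomposition M P S A" and C: "countable C" "C \<subseteq> {0..<1}"
  shows "C \<in> sets M" "emeasure S C = 0" "emeasure A C = 0"
proof -
  have singl: "{t} \<in> sets S" if "t \<in> C" for t
    using that C(2) by (auto simp: lebesgue_decompositionD(2)[OF d] sets sets_torus_borel)
  show "C \<in> sets M"
    using C sets.countable[of C borel] by (simp add: sets sets_torus_borel)
  have "emeasure S {t} = 0" if "t \<in> C" for t
  proof -
    have "t \<in> space S"
      using that C(2) lebesgue_decompositionD(5)[OF d] space_eq by blast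
    then show ?thesis
      using lebesgue_decompositionD(8)[OF d] unfolding singular_continuous_def by blast
  qed
  then have "(\<Union>t\<in>C. {t}) \<in> null_sets S"
    using singl by (intro null_sets_UN' C(1)) auto
  then show "emeasure S C = 0" by auto
  show "emeasure A C = 0"
    using lebesgue_decompositionD(9)[OF d] countable_null_sets_torus_lebesgue[OF C]
    unfolding absolutely_continuous_def by blast
qed

lemma null_by_split:
  assumes "sets N = sets M" "E \<in> sets M" "emeasure N E = 0" "emeasure N (space M - E) = 0" "F \<in> sets M"
  shows "emeasure N F = 0"
proof -
  have "emeasure N (space M) \<le> emeasure N E + emeasure N (space M - E)"
    using emeasure_subadditive[of E N "space M - E"] assms sets.sets_into_space[OF assms(2)]
    by (simp add: Un_absorb1)
  then have "emeasure N (space M) = 0" using assms by simp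
  then show ?thesis
    using emeasure_mono[of F "space M" N] assms sets.sets_into_space[OF assms(5)] by simp
qed

lemma decomposition_trivial:
  assumes "lebesgue_decomposition M P S A"
  shows "(\<forall>F\<in>sets M. emeasure S F = 0) \<Longrightarrow> (\<forall>F\<in>sets M. emeasure A F = 0) \<Longrightarrow> P = M"
    and "(\<forall>F\<in>sets M. emeasure P F = 0) \<Longrightarrow> (\<forall>F\<in>sets M. emeasure A F = 0) \<Longrightarrow> S = M"
    and "(\<forall>F\<in>sets M. emeasure P F = 0) \<Longrightarrow> (\<forall>F\<in>sets M. emeasure S F = 0) \<Longrightarrow> A = M"
  using lebesgue_decompositionD(1-3,6)[OF assms] by (intro measure_eqI; simp)+

lemma sets_lebesgue: "sets M = sets torus_lebesgue"
  by (simp add: sets torus_borel_def torus_lebesgue_def sets_restrict_space)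

text \<open>As \<open>pp_part\<close> is a definite description, the trivial decomposition must be
  shown to be the only one: the countable set carrying \<open>M\<close> also carries
  \<open>S\<close> and \<open>A\<close>, which vanish on countable sets.\<close>

lemma pure_point_spectrally_pure:
  assumes "pure_point M"
  shows "spectrally_pure M"
proof -
  obtain C where C: "countable C" "C \<subseteq> {0..<1}" "emeasure M (space M - C) = 0"
    using assms space_eq by (auto simp: pure_point_def)
  have "lebesgue_decomposition M M (null_measure M) (null_measure M)"
    using assms absolutely_continuous_null_measure[OF sets_lebesgue]
    by (simp add: lebesgue_decomposition_def singular_continuous_null_measure)
  moreover have "P = M" if d: "lebesgue_decomposition M P S A" for P S A
  proof (rule decomposition_trivial(1)[OF d]; intro ballI)
    note c = decomposition_countable[OF d C(1,2)]
    note n = decomposition_null[OF d sets.compl_sets[OF c(1)] C(3)]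
    show "emeasure S F = 0" "emeasure A F = 0" if "F \<in> sets M" for F
      using null_by_split[OF lebesgue_decompositionD(2)[OF d] c(1,2) n(2) that]
        null_by_split[OF lebesgue_decompositionD(3)[OF d] c(1,3) n(3) that] by blast+
  qed
  ultimately have "pp_part M = M"
    unfolding pp_part_def by (intro the_equality) blast+
  then show ?thesis by (simp add: spectrally_pure_def)
qed

text \<open>\<open>P\<close> is carried by a countable set, whose points are null for
  \<open>M\<close> and hence for the smaller measure \<open>P\<close>.\<close>

lemma decomposition_no_atoms:
  assumes d: "lebesgue_decomposition M P S A" and atoms: "\<And>t. t \<in> space M \<Longrightarrow> emeasure M {t} = 0"
    and F: "F \<in> sets M"
  shows "emeasure P F = 0"
proof -
  note sP = lebesgue_decompositionD(1)[OF d]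
  have spP: "space P = {0..<1}"
    using lebesgue_decompositionD(4)[OF d] space_eq by simp
  obtain C where C: "countable C" "C \<subseteq> {0..<1}" "emeasure P (space P - C) = 0"
    using lebesgue_decompositionD(7)[OF d] spP unfolding pure_point_def by blast
  note c = decomposition_countable[OF d C(1,2)]
  have "{t} \<in> null_sets P" if "t \<in> C" for t
  proof -
    have "{t} \<in> sets M" "emeasure M {t} = 0"
      using that C atoms[of t] space_eq sets by (auto simp: sets_torus_borel)
    then show ?thesis
      using decomposition_null(1)[OF d] sP by auto
  qed
  then have "(\<Union>t\<in>C. {t}) \<in> null_sets P"
    by (intro null_sets_UN' C(1))
  then have "emeasure P C = 0" by auto
  then show ?thesis
    using null_by_split[OF sP c(1) _ _ F] C(3) spP space_eq by simp
qed

text \<open>In any decomposition \<open>P\<close> vanishes for lack of atoms, and \<open>A\<close>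
  vanishes on the Lebesgue null set that carries \<open>M\<close>.\<close>

lemma singular_continuous_spectrally_pure:
  assumes "singular_continuous M"
  shows "spectrally_pure M"
proof -
  obtain Z where Z: "Z \<in> null_sets torus_lebesgue" "emeasure M (space M - Z) = 0"
    and atoms: "\<And>t. t \<in> space M \<Longrightarrow> emeasure M {t} = 0"
    using assms by (auto simp: singular_continuous_def)
  have ZM: "Z \<in> sets M"
    using Z(1) sets_lebesgue by auto
  have "lebesgue_decomposition M (null_measure M) M (null_measure M)"
    using assms absolutely_continuous_null_measure[OF sets_lebesgue]
    by (simp add: lebesgue_decomposition_def pure_point_null_measure)
  moreover have "S = M" if d: "lebesgue_decomposition M P S A" for P S A
  proof (rule decomposition_trivial(2)[OF d]; intro ballI)
    show "emeasure P F = 0" if "F \<in> sets M" for F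
      by (rule decomposition_no_atoms[OF d atoms that])
    have "emeasure A Z = 0"
      using lebesgue_decompositionD(9)[OF d] Z(1) unfolding absolutely_continuous_def by blast
    then show "emeasure A F = 0" if "F \<in> sets M" for F
      using null_by_split[OF lebesgue_decompositionD(3)[OF d] ZM _ _ that]
        decomposition_null(3)[OF d sets.compl_sets[OF ZM] Z(2)] by blast
  qed
  ultimately have "sc_part M = M"
    unfolding sc_part_def by (intro the_equality) blast+
  then show ?thesis by (simp add: spectrally_pure_def)
qed

text \<open>Points are Lebesgue null, so \<open>M\<close> has no atoms and \<open>P\<close>
  vanishes. \<open>S\<close> is carried by a Lebesgue null set, which is null for \<open>M\<close>
  and therefore for \<open>S\<close>.\<close>

lemma absolutely_continuous_spectrally_pure:
  assumes "absolutely_continuous torus_lebesgue M"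
  shows "spectrally_pure M"
proof -
  have null: "emeasure M Z = 0" if "Z \<in> null_sets torus_lebesgue" for Z
    using assms that by (auto simp: absolutely_continuous_def)
  have atoms: "emeasure M {t} = 0" if "t \<in> space M" for t
    using that space_eq by (intro null countable_null_sets_torus_lebesgue) auto
  have "lebesgue_decomposition M (null_measure M) (null_measure M) M"
    using assms
    by (simp add: lebesgue_decomposition_def pure_point_null_measure singular_continuous_null_measure)
  moreover have "A = M" if d: "lebesgue_decomposition M P S A" for P S A
  proof (rule decomposition_trivial(3)[OF d]; intro ballI)
    show "emeasure P F = 0" if "F \<in> sets M" for F
      by (rule decomposition_no_atoms[OF d atoms that])
    note S = lebesgue_decompositionD(2,5)[OF d]
    obtain Z where Z: "Z \<in> null_sets torus_lebesgue" "emeasure S (space S - Z) = 0"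
      using lebesgue_decompositionD(8)[OF d] unfolding singular_continuous_def by blast
    have ZM: "Z \<in> sets M"
      using Z(1) sets_lebesgue by auto
    show "emeasure S F = 0" if "F \<in> sets M" for F
      using null_by_split[OF S(1) ZM _ _ that] decomposition_null(2)[OF d ZM null[OF Z(1)]] Z(2) S by simp
  qed
  ultimately have "ac_part M = M"
    unfolding ac_part_def by (intro the_equality) blast+
  then show ?thesis by (simp add: spectrally_pure_def)
qed

end

text \<open>Preimages make measurability immediate; the maps form a group, so images would give the
  same union.\<close>

definition rational_affine_orbit :: "real set \<Rightarrow> real set" where
  "rational_affine_orbit E = (\<Union>p\<in>\<rat> - {0}. \<Union>q\<in>\<rat>. (\<lambda>t. q + p * t) -` E)"

lemma subset_rational_affine_orbit: "E \<subseteq> rational_affine_orbit E"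
proof
  fix t assume "t \<in> E"
  then have "t \<in> (\<lambda>t. 0 + 1 * t) -` E" by simp
  moreover have "(1 :: real) \<in> \<rat> - {0}" "(0 :: real) \<in> \<rat>" by auto
  ultimately show "t \<in> rational_affine_orbit E"
    unfolding rational_affine_orbit_def by blast
qed

lemma rational_affine_invariant_orbit: "rational_affine_invariant (rational_affine_orbit E)"
proof -
  have *: "p * t + q \<in> rational_affine_orbit E"
    if t: "t \<in> rational_affine_orbit E" and p: "p \<in> \<rat>" "p \<noteq> 0" and q: "q \<in> \<rat>" for p q t
  proof -
    obtain p' q' where p': "p' \<in> \<rat>" "p' \<noteq> 0" and q': "q' \<in> \<rat>" and E: "q' + p' * t \<in> E"
      using t by (auto simp: rational_affine_orbit_def)
    \<comment> \<open>The coefficients are those of \<open>t \<mapsto> q' + p' * t\<close> composed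
      with the inverse of \<open>t \<mapsto> p * t + q\<close>.\<close>
    have "(q' - p' / p * q) + p' / p * (p * t + q) = q' + p' * t"
      using p by (simp add: field_simps)
    with E have "p * t + q \<in> (\<lambda>t. (q' - p' / p * q) + p' / p * t) -` E"
      by (simp only: vimage_eq)
    moreover have "p' / p \<in> \<rat> - {0}" "q' - p' / p * q \<in> \<rat>"
      using p p' q q' by (auto intro: Rats_divide Rats_diff Rats_mult)
    ultimately show ?thesis
      unfolding rational_affine_orbit_def by blast
  qed
  have "t \<in> rational_affine_orbit E"
    if "p * t + q \<in> rational_affine_orbit E" and p: "p \<in> \<rat>" "p \<noteq> 0" and q: "q \<in> \<rat>" for p q t
  proof -
    have "1 / p * (p * t + q) + - q / p \<in> rational_affine_orbit E"
      using p q by (intro * that(1)) (auto intro: Rats_divide)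
    then show ?thesis
      using p by (simp add: field_simps)
  qed
  then show ?thesis
    unfolding rational_affine_invariant_def using * by blast
qed

lemma rational_affine_orbit_borel:
  assumes "E \<in> sets borel"
  shows "rational_affine_orbit E \<in> sets borel"
proof -
  have "(\<lambda>t. q + p * t) -` E \<in> sets borel" for p q :: real
    using assms measurable_sets[of "\<lambda>t. q + p * t" borel borel E] by simp
  then show ?thesis
    unfolding rational_affine_orbit_def
    by (intro sets.countable_UN'' countable_Diff countable_rat)
qed

lemma countable_rational_affine_orbit: "countable (rational_affine_orbit {t})"
  unfolding rational_affine_orbit_def
proof (intro countable_UN countable_Diff countable_rat)
  fix p q :: real assume "p \<in> \<rat> - {0}"
  then have "(\<lambda>s. q + p * s) -` {t} \<subseteq> {(t - q) / p}"
    by (auto simp: field_simps)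
  then show "countable ((\<lambda>s. q + p * s) -` {t})"
    by (rule countable_subset) simp
qed

lemma null_rational_affine_orbit:
  assumes "E \<in> null_sets lborel"
  shows "rational_affine_orbit E \<in> null_sets lborel"
  unfolding rational_affine_orbit_def
proof (intro null_sets_UN' countable_Diff countable_rat)
  fix p q :: real assume p: "p \<in> \<rat> - {0}"
  have E: "E \<in> sets borel"
    using assms by auto
  have "(\<lambda>t. q + p * t) -` E \<in> sets borel"
    using E measurable_sets[of "\<lambda>t. q + p * t" borel borel E] by simp
  moreover have "AE t in lborel. q + p * t \<notin> E"
    using p E assms AE_not_in[OF assms] by (intro AE_borel_affine) auto
  ultimately show "(\<lambda>t. q + p * t) -` E \<in> null_sets lborel"
    by (subst AE_iff_null_sets) auto
qed

text \<open>The orbit of a set of positive mass is invariant and of positive mass, so it carries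
  \<open>M\<close>. Applied to an atom this gives a countable carrier; without atoms, a Lebesgue
  null set charged by \<open>M\<close> gives a null carrier.\<close>

lemma zero_one_imp_spectrally_pure:
  assumes sets: "sets M = sets torus_borel" and fin: "finite_measure M"
    and zero_one: "\<And>E. E \<in> sets borel \<Longrightarrow> rational_affine_invariant E \<Longrightarrow>
      measure M (E \<inter> {0..<1}) = 0 \<or> measure M ({0..<1} - E) = 0"
  shows "spectrally_pure M"
proof -
  interpret finite_measure M by fact
  note space = space_eq[OF sets]
  have full: "emeasure M (space M - rational_affine_orbit E \<inter> {0..<1}) = 0"
    if E: "E \<in> sets M" "emeasure M E \<noteq> 0" for E
  proof -
    have Eb: "E \<in> sets borel" "E \<subseteq> {0..<1}"
      using E(1) by (auto simp: sets sets_torus_borel)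
    have O: "rational_affine_orbit E \<in> sets borel"
      using Eb(1) by (rule rational_affine_orbit_borel)
    have "emeasure M E \<le> emeasure M (rational_affine_orbit E \<inter> {0..<1})"
      using O Eb subset_rational_affine_orbit[of E] by (intro emeasure_mono) (auto simp: sets sets_torus_borel)
    then have "measure M (rational_affine_orbit E \<inter> {0..<1}) \<noteq> 0"
      using E(2) by (auto simp: emeasure_eq_measure measure_le_0_iff)
    then have "measure M ({0..<1} - rational_affine_orbit E) = 0"
      using zero_one[OF O rational_affine_invariant_orbit] by blast
    moreover have "space M - rational_affine_orbit E \<inter> {0..<1} = {0..<1} - rational_affine_orbit E"
      by (auto simp: space)
    ultimately show ?thesis
      by (simp add: emeasure_eq_measure)
  qed
  show ?thesis
  proof (cases "\<exists>t\<in>space M. emeasure M {t} \<noteq> 0")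
    case True
    then obtain t where t: "t \<in> {0..<1}" "emeasure M {t} \<noteq> 0"
      by (auto simp: space)
    then have "emeasure M (space M - rational_affine_orbit {t} \<inter> {0..<1}) = 0"
      by (intro full) (auto simp: sets sets_torus_borel)
    then have "pure_point M"
      unfolding pure_point_def space using countable_rational_affine_orbit
      by (intro exI[of _ "rational_affine_orbit {t} \<inter> {0..<1}"]) auto
    then show ?thesis
      by (rule pure_point_spectrally_pure[OF sets])
  next
    case no_atoms: False
    show ?thesis
    proof (cases "absolutely_continuous torus_lebesgue M")
      case True
      then show ?thesis
        by (rule absolutely_continuous_spectrally_pure[OF sets])
    next
      case False
      then obtain E where E: "E \<in> null_sets torus_lebesgue" "E \<notin> null_sets M"
        by (auto simp: absolutely_continuous_def)
      then have "E \<in> sets M"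
        using sets_lebesgue[OF sets] by auto
      then have "emeasure M (space M - rational_affine_orbit E \<inter> {0..<1}) = 0"
        using E(2) by (intro full) auto
      moreover have "rational_affine_orbit E \<inter> {0..<1} \<in> null_sets torus_lebesgue"
        using null_rational_affine_orbit[of E] E(1)
        by (auto simp: null_sets_torus_lebesgue intro: null_set_Int2)
      ultimately have "singular_continuous M"
        using no_atoms by (auto simp: singular_continuous_def)
      then show ?thesis
        by (rule singular_continuous_spectrally_pure[OF sets])
    qed
  qed
qed

theorem theorem5:
  fixes k :: nat and f :: "nat \<Rightarrow> real"
    and w x :: "real^'d" and B :: "nat \<Rightarrow> real^'d^'d"
  assumes "k \<ge> 2"
    and "\<And>n. f n \<ge> 0"
    and "reduced_representation k f w B x"
    and "unique_maximal_eigenvalue (complexify (B_hat_sum k w B x))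
           (complex_of_real (rep_radius k w B))"
    and "simple_eigenvalue (complexify (B_hat_sum k w B x))
           (complex_of_real (rep_radius k w B))"
  shows "spectrally_pure (the_ghost_measure k f)"
proof -
  interpret block_weights k f "rep_radius k w B"
    using assms(1-3) reduced_representation_recursion[OF assms(1,3)]
    by unfold_locales (simp_all add: reduced_representation_def)
  \<comment> \<open>Uniqueness identifies the definite description with the measure constructed
    above.\<close>
  have "\<exists>!\<nu>. ghost_measure k f \<nu>"
    using assms(3) by (simp add: reduced_representation_def)
  then have ghost: "the_ghost_measure k f = torus_ghost"
    unfolding the_ghost_measure_def using ghost_measure_torus_ghost by (rule the1_equality)
  have "measure torus_ghost (E \<inter> {0..<1}) = 0 \<or> measure torus_ghost ({0..<1} - E) = 0"
    if E: "E \<in> sets borel" and inv: "rational_affine_invariant E" for E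
  proof -
    \<comment> \<open>By invariance, the preimages of \<open>E\<close> in the self-similarity
      relation are \<open>E\<close> itself.\<close>
    have "(\<Sum>a<k. measure (cylinder_measure (n * k + a)) E) =
        rep_radius k w B * measure (cylinder_measure n) E" if "n \<ge> 1" for n
      using cylinder_measure_self_similar[OF that E] rational_affine_invariantD[OF inv] k rho_pos
      by simp
    then obtain c where "\<forall>n\<ge>1. measure (cylinder_measure n) E = c * f n"
      using proportional_to_sequence[OF assms(1,3,5), of "\<lambda>n. measure (cylinder_measure n) E"]
        cylinder_measure_relation[OF _ _ _ E] by blast
    then show ?thesis
      by (intro torus_ghost_zero_one[OF E inv]) auto
  qed
  then show ?thesis
    unfolding ghost
    using zero_one_imp_spectrally_pure[OF sets_torus_ghost] prob_space_torus_ghost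
    by (simp add: prob_space_def)
qed

end
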